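(* Let $R$ be a commutative refinement ring and let $M$ and $N$ be finitely generated projective $R$-modules. Then $M\cong N$ if and only if $M_P\cong N_P$ for every maximal ideal $P$ of $R$.
   Context: A ring $R$ is a refinement ring if the monoid $V(R)$ of isomorphism classes of finitely generated projective $R$-modules (under direct sum) has the refinement property: whenever $x_1+x_2=y_1+y_2$ in $V(R)$, there exist $z_{ij}\in V(R)$ with $x_i=z_{i1}+z_{i2}$ and $y_j=z_{1j}+z_{2j}$. $M_P=M\otimes_R R_P$ denotes localization at $P$. *)

theory Defs
  imports "HOL-Algebra.Module" "HOL-Algebra.Ideal"
begin

definition mod_hom ::
  "('a, 'r) ring_scheme \<Rightarrow> ('a, 'm) module \<Rightarrow> ('a, 'n) module \<Rightarrow> ('m \<Rightarrow> 'n) \<Rightarrow> bool" where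
  "mod_hom R M N f \<longleftrightarrow>
     f \<in> carrier M \<rightarrow> carrier N \<and>
     (\<forall>x\<in>carrier M. \<forall>y\<in>carrier M. f (x \<oplus>\<^bsub>M\<^esub> y) = f x \<oplus>\<^bsub>N\<^esub> f y) \<and>
     (\<forall>a\<in>carrier R. \<forall>x\<in>carrier M. f (a \<odot>\<^bsub>M\<^esub> x) = a \<odot>\<^bsub>N\<^esub> f x)"

definition mod_iso ::
  "('a, 'r) ring_scheme \<Rightarrow> ('a, 'm) module \<Rightarrow> ('a, 'n) module \<Rightarrow> bool" where
  "mod_iso R M N \<longleftrightarrow> (\<exists>f. mod_hom R M N f \<and> bij_betw f (carrier M) (carrier N))"

definition free_mod :: "('a, 'r) ring_scheme \<Rightarrow> nat \<Rightarrow> ('a, nat \<Rightarrow> 'a) module" where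
  "free_mod R n = \<lparr> carrier = {..<n} \<rightarrow>\<^sub>E carrier R,
      monoid.mult = (\<lambda>_ _. undefined), one = undefined,
      zero = (\<lambda>i\<in>{..<n}. \<zero>\<^bsub>R\<^esub>),
      add = (\<lambda>v w. \<lambda>i\<in>{..<n}. v i \<oplus>\<^bsub>R\<^esub> w i),
      smult = (\<lambda>a v. \<lambda>i\<in>{..<n}. a \<otimes>\<^bsub>R\<^esub> v i) \<rparr>"

definition dsum :: "('a, 'm) module \<Rightarrow> ('a, 'n) module \<Rightarrow> ('a, 'm \<times> 'n) module" where
  "dsum M N = \<lparr> carrier = carrier M \<times> carrier N,
      monoid.mult = (\<lambda>_ _. undefined), one = undefined,
      zero = (\<zero>\<^bsub>M\<^esub>, \<zero>\<^bsub>N\<^esub>),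
      add = (\<lambda>(x, y) (x', y'). (x \<oplus>\<^bsub>M\<^esub> x', y \<oplus>\<^bsub>N\<^esub> y')),
      smult = (\<lambda>a (x, y). (a \<odot>\<^bsub>M\<^esub> x, a \<odot>\<^bsub>N\<^esub> y)) \<rparr>"

definition fg_projective :: "('a, 'r) ring_scheme \<Rightarrow> ('a, 'm) module \<Rightarrow> bool" where
  "fg_projective R M \<longleftrightarrow> module R M \<and>
     (\<exists>n p s. mod_hom R (free_mod R n) M p \<and> mod_hom R M (free_mod R n) s \<and>
              (\<forall>x\<in>carrier M. p (s x) = x))"

text \<open>Every finitely generated projective module is isomorphic to a submodule of some R^n,
  hence to a module with carrier of type nat => 'a; so quantifying over such modules
  ranges over all of V(R).  Addition in V(R) is the direct sum.\<close>

definition refinement_ring :: "('a, 'r) ring_scheme \<Rightarrow> bool" where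
  "refinement_ring R \<longleftrightarrow>
     (\<forall>(X1 :: ('a, nat \<Rightarrow> 'a) module) (X2 :: ('a, nat \<Rightarrow> 'a) module)
         (Y1 :: ('a, nat \<Rightarrow> 'a) module) (Y2 :: ('a, nat \<Rightarrow> 'a) module).
        fg_projective R X1 \<and> fg_projective R X2 \<and> fg_projective R Y1 \<and> fg_projective R Y2 \<and>
        mod_iso R (dsum X1 X2) (dsum Y1 Y2) \<longrightarrow>
        (\<exists>(Z11 :: ('a, nat \<Rightarrow> 'a) module) (Z12 :: ('a, nat \<Rightarrow> 'a) module)
           (Z21 :: ('a, nat \<Rightarrow> 'a) module) (Z22 :: ('a, nat \<Rightarrow> 'a) module).
           fg_projective R Z11 \<and> fg_projective R Z12 \<and>
           fg_projective R Z21 \<and> fg_projective R Z22 \<and>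
           mod_iso R X1 (dsum Z11 Z12) \<and> mod_iso R X2 (dsum Z21 Z22) \<and>
           mod_iso R Y1 (dsum Z11 Z21) \<and> mod_iso R Y2 (dsum Z12 Z22)))"

definition loc_rel :: "('a, 'r) ring_scheme \<Rightarrow> 'a set \<Rightarrow> ('a \<times> 'a) \<Rightarrow> ('a \<times> 'a) \<Rightarrow> bool" where
  "loc_rel R P = (\<lambda>(r, s) (r', s'). \<exists>t\<in>carrier R - P.
      t \<otimes>\<^bsub>R\<^esub> (r \<otimes>\<^bsub>R\<^esub> s' \<ominus>\<^bsub>R\<^esub> r' \<otimes>\<^bsub>R\<^esub> s) = \<zero>\<^bsub>R\<^esub>)"

definition loc_class :: "('a, 'r) ring_scheme \<Rightarrow> 'a set \<Rightarrow> ('a \<times> 'a) \<Rightarrow> ('a \<times> 'a) set" where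
  "loc_class R P q = {q' \<in> carrier R \<times> (carrier R - P). loc_rel R P q' q}"

definition loc_ring :: "('a, 'r) ring_scheme \<Rightarrow> 'a set \<Rightarrow> ('a \<times> 'a) set ring" where
  "loc_ring R P = \<lparr>
     carrier = loc_class R P ` (carrier R \<times> (carrier R - P)),
     monoid.mult = (\<lambda>X Y. \<Union>(r, s)\<in>X. \<Union>(r', s')\<in>Y.
                      loc_class R P (r \<otimes>\<^bsub>R\<^esub> r', s \<otimes>\<^bsub>R\<^esub> s')),
     one = loc_class R P (\<one>\<^bsub>R\<^esub>, \<one>\<^bsub>R\<^esub>),
     zero = loc_class R P (\<zero>\<^bsub>R\<^esub>, \<one>\<^bsub>R\<^esub>),
     add = (\<lambda>X Y. \<Union>(r, s)\<in>X. \<Union>(r', s')\<in>Y.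
              loc_class R P (r \<otimes>\<^bsub>R\<^esub> s' \<oplus>\<^bsub>R\<^esub> r' \<otimes>\<^bsub>R\<^esub> s, s \<otimes>\<^bsub>R\<^esub> s')) \<rparr>"

definition locm_rel ::
  "('a, 'r) ring_scheme \<Rightarrow> ('a, 'm) module \<Rightarrow> 'a set \<Rightarrow> ('m \<times> 'a) \<Rightarrow> ('m \<times> 'a) \<Rightarrow> bool" where
  "locm_rel R M P = (\<lambda>(m, s) (m', s'). \<exists>t\<in>carrier R - P.
      t \<odot>\<^bsub>M\<^esub> (s' \<odot>\<^bsub>M\<^esub> m \<ominus>\<^bsub>M\<^esub> s \<odot>\<^bsub>M\<^esub> m') = \<zero>\<^bsub>M\<^esub>)"

definition locm_class ::
  "('a, 'r) ring_scheme \<Rightarrow> ('a, 'm) module \<Rightarrow> 'a set \<Rightarrow> ('m \<times> 'a) \<Rightarrow> ('m \<times> 'a) set" where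
  "locm_class R M P q = {q' \<in> carrier M \<times> (carrier R - P). locm_rel R M P q' q}"

definition loc_mod ::
  "('a, 'r) ring_scheme \<Rightarrow> ('a, 'm) module \<Rightarrow> 'a set \<Rightarrow> (('a \<times> 'a) set, ('m \<times> 'a) set) module" where
  "loc_mod R M P = \<lparr>
     carrier = locm_class R M P ` (carrier M \<times> (carrier R - P)),
     monoid.mult = (\<lambda>_ _. undefined), one = undefined,
     zero = locm_class R M P (\<zero>\<^bsub>M\<^esub>, \<one>\<^bsub>R\<^esub>),
     add = (\<lambda>X Y. \<Union>(m, s)\<in>X. \<Union>(m', s')\<in>Y.
              locm_class R M P (s' \<odot>\<^bsub>M\<^esub> m \<oplus>\<^bsub>M\<^esub> s \<odot>\<^bsub>M\<^esub> m', s \<otimes>\<^bsub>R\<^esub> s')),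
     smult = (\<lambda>A X. \<Union>(a, s)\<in>A. \<Union>(m, s')\<in>X.
              locm_class R M P (a \<odot>\<^bsub>M\<^esub> m, s \<otimes>\<^bsub>R\<^esub> s')) \<rparr>"

end

theory Submission
  imports Defs
begin

text \<open>Over a refinement ring, refining $M \oplus M' \cong R^n = R \oplus \dots \oplus R$ splits $M$ into
  direct summands of $R$, that is, into modules $eR$ with $e$ idempotent. At a prime $P$ each such
  $e$ may be replaced by $1$ or by $0$ after multiplying by an idempotent outside $P$, so $gM$ is
  free over $gR$ for some idempotent $g \notin P$. A local isomorphism $M_P \cong N_P$, with
  denominators cleared, makes the ranks of $M$ and $N$ agree at $P$, hence $gM \cong gN$ for some
  idempotent $g \notin P$. Such idempotents are closed under joins, so they generate an ideal all
  of whose elements are fixed by one of them; being in no maximal ideal, it contains $1$.\<close>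

text \<open>Isomorphisms over basic open sets of the spectrum need not glue: a line bundle can be
  locally trivial without being trivial. Over the open and closed sets cut out by idempotents they
  always glue, because a finite cover by such sets can be refined to a disjoint one. The scalar
  obtained by clearing denominators is in general not idempotent, so the local isomorphism itself is
  never glued. It serves only to compare two ranks at \<open>P\<close>; the isomorphism that is
  glued is a new one, through a common free module. Refinement is what supplies free modules over
  idempotents rather than over mere open neighbourhoods. Since \<open>refinement_ring\<close> speaks
  of modules with carrier type \<open>nat \<Rightarrow> 'a\<close>, a projective module of another
  type has to be exchanged for a summand of R^n before it applies.\<close>

text \<open>Isomorphism up to multiplication by \<open>g\<close>: for idempotent \<open>g\<close> it says $gM \cong gN$, and
  $M_P \cong N_P$ amounts to it for some \<open>g\<close> outside \<open>P\<close>, so both are treated without forming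
  submodules or quotients.\<close>

definition iso_upto ::
  "('a, 'r) ring_scheme \<Rightarrow> 'a \<Rightarrow> ('a, 'm) module \<Rightarrow> ('a, 'n) module \<Rightarrow> bool" where
  "iso_upto R g M N \<longleftrightarrow> g \<in> carrier R \<and>
     (\<exists>\<phi> \<psi>. mod_hom R M N \<phi> \<and> mod_hom R N M \<psi> \<and>
        (\<forall>x\<in>carrier M. \<psi> (\<phi> x) = g \<odot>\<^bsub>M\<^esub> x) \<and>
        (\<forall>y\<in>carrier N. \<phi> (\<psi> y) = g \<odot>\<^bsub>N\<^esub> y))"

section \<open>Module homomorphisms and isomorphism up to a scalar\<close>

lemma mod_homD:
  assumes "mod_hom R M N f"
  shows "x \<in> carrier M \<Longrightarrow> f x \<in> carrier N"
    and "x \<in> carrier M \<Longrightarrow> y \<in> carrier M \<Longrightarrow> f (x \<oplus>\<^bsub>M\<^esub> y) = f x \<oplus>\<^bsub>N\<^esub> f y"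
    and "a \<in> carrier R \<Longrightarrow> x \<in> carrier M \<Longrightarrow> f (a \<odot>\<^bsub>M\<^esub> x) = a \<odot>\<^bsub>N\<^esub> f x"
  using assms by (auto simp: mod_hom_def)

lemma mod_homI:
  assumes "\<And>x. x \<in> carrier M \<Longrightarrow> f x \<in> carrier N"
    and "\<And>x y. x \<in> carrier M \<Longrightarrow> y \<in> carrier M \<Longrightarrow> f (x \<oplus>\<^bsub>M\<^esub> y) = f x \<oplus>\<^bsub>N\<^esub> f y"
    and "\<And>a x. a \<in> carrier R \<Longrightarrow> x \<in> carrier M \<Longrightarrow> f (a \<odot>\<^bsub>M\<^esub> x) = a \<odot>\<^bsub>N\<^esub> f x"
  shows "mod_hom R M N f"
  using assms by (auto simp: mod_hom_def)

lemma mod_hom_comp: "mod_hom R M N f \<Longrightarrow> mod_hom R N L g \<Longrightarrow> mod_hom R M L (\<lambda>x. g (f x))"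
  by (intro mod_homI) (simp_all add: mod_homD)

lemma mod_hom_zero:
  assumes "module R M" "module R N" "mod_hom R M N f"
  shows "f \<zero>\<^bsub>M\<^esub> = \<zero>\<^bsub>N\<^esub>"
proof -
  interpret M: module R M by fact
  interpret N: module R N by fact
  have "f (\<zero>\<^bsub>R\<^esub> \<odot>\<^bsub>M\<^esub> \<zero>\<^bsub>M\<^esub>) = \<zero>\<^bsub>R\<^esub> \<odot>\<^bsub>N\<^esub> f \<zero>\<^bsub>M\<^esub>"
    using assms(3) by (simp only: mod_homD M.R.zero_closed M.M.zero_closed)
  then show ?thesis using mod_homD(1)[OF assms(3)] by simp
qed

lemma mod_hom_finsum:
  assumes "module R M" "module R N" "mod_hom R M N f"
    and "finite A" "x \<in> A \<rightarrow> carrier M"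
  shows "f (finsum M x A) = finsum N (\<lambda>i. f (x i)) A"
proof -
  interpret M: module R M by fact
  interpret N: module R N by fact
  show ?thesis
    using assms(4,5)
  proof (induction A rule: finite_induct)
    case empty
    then show ?case using mod_hom_zero[OF assms(1-3)] by simp
  next
    case (insert i A)
    then have "x \<in> A \<rightarrow> carrier M" "x i \<in> carrier M" by auto
    with insert show ?case
      by (simp add: mod_homD[OF assms(3)] Pi_iff)
  qed
qed

lemma mod_hom_smult:
  assumes "module R N" "mod_hom R M N f" "g \<in> carrier R"
  shows "mod_hom R M N (\<lambda>x. g \<odot>\<^bsub>N\<^esub> f x)"
proof -
  interpret N: module R N by fact
  have "g \<odot>\<^bsub>N\<^esub> (a \<odot>\<^bsub>N\<^esub> f x) = a \<odot>\<^bsub>N\<^esub> (g \<odot>\<^bsub>N\<^esub> f x)" if "a \<in> carrier R" "x \<in> carrier M" for a x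
    using that assms(3) mod_homD(1)[OF assms(2)]
    by (simp add: N.smult_assoc1[symmetric] N.R.m_comm)
  with assms(3) show ?thesis
    by (intro mod_homI) (simp_all add: mod_homD[OF assms(2)] N.smult_r_distr)
qed

lemma mod_hom_add:
  assumes "module R N" "mod_hom R M N f" "mod_hom R M N g"
  shows "mod_hom R M N (\<lambda>x. f x \<oplus>\<^bsub>N\<^esub> g x)"
proof -
  interpret N: module R N by fact
  show ?thesis
    by (intro mod_homI)
      (simp_all add: mod_homD[OF assms(2)] mod_homD[OF assms(3)] N.smult_r_distr N.M.add.m_ac)
qed

lemma iso_uptoI:
  assumes "g \<in> carrier R" "mod_hom R M N \<phi>" "mod_hom R N M \<psi>"
    "\<And>x. x \<in> carrier M \<Longrightarrow> \<psi> (\<phi> x) = g \<odot>\<^bsub>M\<^esub> x"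
    "\<And>y. y \<in> carrier N \<Longrightarrow> \<phi> (\<psi> y) = g \<odot>\<^bsub>N\<^esub> y"
  shows "iso_upto R g M N"
  unfolding iso_upto_def using assms by blast

lemma iso_uptoE:
  assumes "iso_upto R g M N"
  obtains \<phi> \<psi> where "g \<in> carrier R" "mod_hom R M N \<phi>" "mod_hom R N M \<psi>"
    "\<And>x. x \<in> carrier M \<Longrightarrow> \<psi> (\<phi> x) = g \<odot>\<^bsub>M\<^esub> x"
    "\<And>y. y \<in> carrier N \<Longrightarrow> \<phi> (\<psi> y) = g \<odot>\<^bsub>N\<^esub> y"
  using assms unfolding iso_upto_def by blast

lemma iso_upto_sym: "iso_upto R g M N \<Longrightarrow> iso_upto R g N M"
  unfolding iso_upto_def by blast

text \<open>The inner composite is a scalar, which linearity carries past the outer map; hence the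
  two scalars multiply.\<close>

lemma iso_upto_trans:
  assumes "module R M" "module R N" "module R L" "iso_upto R g M N" "iso_upto R h N L"
  shows "iso_upto R (g \<otimes>\<^bsub>R\<^esub> h) M L"
proof -
  interpret M: module R M by fact
  interpret N: module R N by fact
  interpret L: module R L by fact
  obtain \<phi> \<psi> where 1: "g \<in> carrier R" "mod_hom R M N \<phi>" "mod_hom R N M \<psi>"
    "\<And>x. x \<in> carrier M \<Longrightarrow> \<psi> (\<phi> x) = g \<odot>\<^bsub>M\<^esub> x"
    "\<And>y. y \<in> carrier N \<Longrightarrow> \<phi> (\<psi> y) = g \<odot>\<^bsub>N\<^esub> y"
    using assms(4) by (rule iso_uptoE) blast
  obtain \<phi>' \<psi>' where 2: "h \<in> carrier R" "mod_hom R N L \<phi>'" "mod_hom R L N \<psi>'"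
    "\<And>x. x \<in> carrier N \<Longrightarrow> \<psi>' (\<phi>' x) = h \<odot>\<^bsub>N\<^esub> x"
    "\<And>y. y \<in> carrier L \<Longrightarrow> \<phi>' (\<psi>' y) = h \<odot>\<^bsub>L\<^esub> y"
    using assms(5) by (rule iso_uptoE) blast
  show ?thesis
  proof (rule iso_uptoI[OF _ mod_hom_comp[OF 1(2) 2(2)] mod_hom_comp[OF 2(3) 1(3)]])
    show "g \<otimes>\<^bsub>R\<^esub> h \<in> carrier R" using 1 2 by simp
    show "\<psi> (\<psi>' (\<phi>' (\<phi> x))) = (g \<otimes>\<^bsub>R\<^esub> h) \<odot>\<^bsub>M\<^esub> x" if "x \<in> carrier M" for x
      using that 1(1) 2(1)
      by (simp add: mod_homD[OF 1(2)] 2(4) mod_homD[OF 1(3)] 1(4) M.smult_assoc1[symmetric]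
          M.R.m_comm)
    show "\<phi>' (\<phi> (\<psi> (\<psi>' y))) = (g \<otimes>\<^bsub>R\<^esub> h) \<odot>\<^bsub>L\<^esub> y" if "y \<in> carrier L" for y
      using that 1(1) 2(1)
      by (simp add: mod_homD[OF 2(3)] 2(5) mod_homD[OF 2(2)] 1(5) L.smult_assoc1[symmetric])
  qed
qed

text \<open>Multiplication by \<open>h\<close>, taken in both directions, relates \<open>M\<close>
  to itself up to the square of \<open>h\<close>, which is \<open>h\<close>. Composing with it is
  how two isomorphisms are brought to a common scalar before a direct sum is formed.\<close>

lemma iso_upto_mult:
  assumes "module R M" "module R N" "iso_upto R g M N" "h \<in> carrier R" "h \<otimes>\<^bsub>R\<^esub> h = h"
  shows "iso_upto R (h \<otimes>\<^bsub>R\<^esub> g) M N"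
proof -
  interpret M: module R M by fact
  have "iso_upto R h M M"
    using assms(4,5)
    by (intro iso_uptoI[where \<phi> = "\<lambda>x. h \<odot>\<^bsub>M\<^esub> x" and \<psi> = "\<lambda>x. h \<odot>\<^bsub>M\<^esub> x"])
      (auto intro!: mod_homI
        simp: M.smult_assoc1[symmetric] M.smult_r_distr M.R.m_comm)
  from iso_upto_trans[OF assms(1,1,2) this assms(3)] show ?thesis .
qed

text \<open>The bridge to the notion of the theorem: the inverse of a linear bijection is linear,
  and conversely two maps whose composites are multiplication by 1 are mutually inverse.\<close>

lemma mod_iso_iff_iso_upto_one:
  assumes "module R M" "module R N"
  shows "mod_iso R M N \<longleftrightarrow> iso_upto R \<one>\<^bsub>R\<^esub> M N"
proof -
  interpret M: module R M by fact
  interpret N: module R N by fact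
  show ?thesis
  proof
    assume "mod_iso R M N"
    then obtain f where f: "mod_hom R M N f" "bij_betw f (carrier M) (carrier N)"
      unfolding mod_iso_def by blast
    let ?h = "inv_into (carrier M) f"
    have h: "?h y \<in> carrier M" "f (?h y) = y" if "y \<in> carrier N" for y
      using that f(2) by (auto simp: bij_betw_def inv_into_into f_inv_into_f)
    have hf: "?h (f x) = x" if "x \<in> carrier M" for x
      using that f(2) by (auto simp: bij_betw_def)
    have "mod_hom R N M ?h"
    proof (rule mod_homI)
      show "?h (y \<oplus>\<^bsub>N\<^esub> y') = ?h y \<oplus>\<^bsub>M\<^esub> ?h y'" if "y \<in> carrier N" "y' \<in> carrier N" for y y'
        using hf[of "?h y \<oplus>\<^bsub>M\<^esub> ?h y'"] that by (simp add: h mod_homD[OF f(1)])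
      show "?h (a \<odot>\<^bsub>N\<^esub> y) = a \<odot>\<^bsub>M\<^esub> ?h y" if "y \<in> carrier N" "a \<in> carrier R" for y a
        using hf[of "a \<odot>\<^bsub>M\<^esub> ?h y"] that by (simp add: h mod_homD[OF f(1)])
    qed (simp add: h)
    with f(1) h hf show "iso_upto R \<one>\<^bsub>R\<^esub> M N"
      by (intro iso_uptoI[where \<phi> = f and \<psi> = ?h]) auto
  next
    assume "iso_upto R \<one>\<^bsub>R\<^esub> M N"
    then obtain \<phi> \<psi> where 1: "mod_hom R M N \<phi>" "mod_hom R N M \<psi>"
      "\<And>x. x \<in> carrier M \<Longrightarrow> \<psi> (\<phi> x) = \<one>\<^bsub>R\<^esub> \<odot>\<^bsub>M\<^esub> x"
      "\<And>y. y \<in> carrier N \<Longrightarrow> \<phi> (\<psi> y) = \<one>\<^bsub>R\<^esub> \<odot>\<^bsub>N\<^esub> y"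
      by (rule iso_uptoE) blast
    then have "bij_betw \<phi> (carrier M) (carrier N)"
      by (intro bij_betw_byWitness[where f' = \<psi>]) (auto simp: mod_homD)
    with 1 show "mod_iso R M N" unfolding mod_iso_def by blast
  qed
qed

section \<open>Direct sums and free modules\<close>

lemma dsum_simps [simp]:
  "carrier (dsum M N) = carrier M \<times> carrier N"
  "\<zero>\<^bsub>dsum M N\<^esub> = (\<zero>\<^bsub>M\<^esub>, \<zero>\<^bsub>N\<^esub>)"
  "(x, y) \<oplus>\<^bsub>dsum M N\<^esub> (x', y') = (x \<oplus>\<^bsub>M\<^esub> x', y \<oplus>\<^bsub>N\<^esub> y')"
  "a \<odot>\<^bsub>dsum M N\<^esub> (x, y) = (a \<odot>\<^bsub>M\<^esub> x, a \<odot>\<^bsub>N\<^esub> y)"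
  by (simp_all add: dsum_def)

lemma dsum_module:
  assumes "module R M" "module R N"
  shows "module R (dsum M N)"
proof -
  interpret M: module R M by fact
  interpret N: module R N by fact
  show ?thesis
  proof (intro moduleI abelian_groupI)
    fix x assume "x \<in> carrier (dsum M N)"
    then obtain m n where x: "x = (m, n)" "m \<in> carrier M" "n \<in> carrier N" by auto
    show "\<exists>y\<in>carrier (dsum M N). y \<oplus>\<^bsub>dsum M N\<^esub> x = \<zero>\<^bsub>dsum M N\<^esub>"
      using x by (intro bexI[of _ "(\<ominus>\<^bsub>M\<^esub> m, \<ominus>\<^bsub>N\<^esub> n)"]) (auto simp: M.M.l_neg N.M.l_neg)
  qed (use M.R.cring_axioms in \<open>auto simp: M.smult_l_distr N.smult_l_distr M.smult_r_distr N.smult_r_distr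
      M.smult_assoc1 N.smult_assoc1 M.M.add.m_ac N.M.add.m_ac\<close>)
qed

lemma mod_hom_dsum:
  assumes "mod_hom R M M' f" "mod_hom R N N' g"
  shows "mod_hom R (dsum M N) (dsum M' N') (map_prod f g)"
  by (intro mod_homI) (auto simp: mod_homD[OF assms(1)] mod_homD[OF assms(2)])

lemma iso_upto_dsum:
  assumes "iso_upto R g M M'" "iso_upto R g N N'"
  shows "iso_upto R g (dsum M N) (dsum M' N')"
proof -
  obtain \<phi> \<psi> where 1: "g \<in> carrier R" "mod_hom R M M' \<phi>" "mod_hom R M' M \<psi>"
    "\<And>x. x \<in> carrier M \<Longrightarrow> \<psi> (\<phi> x) = g \<odot>\<^bsub>M\<^esub> x"
    "\<And>y. y \<in> carrier M' \<Longrightarrow> \<phi> (\<psi> y) = g \<odot>\<^bsub>M'\<^esub> y"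
    using assms(1) by (rule iso_uptoE) blast
  obtain \<phi>' \<psi>' where 2: "mod_hom R N N' \<phi>'" "mod_hom R N' N \<psi>'"
    "\<And>x. x \<in> carrier N \<Longrightarrow> \<psi>' (\<phi>' x) = g \<odot>\<^bsub>N\<^esub> x"
    "\<And>y. y \<in> carrier N' \<Longrightarrow> \<phi>' (\<psi>' y) = g \<odot>\<^bsub>N'\<^esub> y"
    using assms(2) by (rule iso_uptoE) blast
  show ?thesis
    by (rule iso_uptoI[OF 1(1) mod_hom_dsum[OF 1(2) 2(1)] mod_hom_dsum[OF 1(3) 2(2)]])
      (auto simp: 1 2)
qed

lemma free_mod_simps [simp]:
  "carrier (free_mod R n) = {..<n} \<rightarrow>\<^sub>E carrier R"
  "\<zero>\<^bsub>free_mod R n\<^esub> = (\<lambda>i\<in>{..<n}. \<zero>\<^bsub>R\<^esub>)"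
  "v \<oplus>\<^bsub>free_mod R n\<^esub> w = (\<lambda>i\<in>{..<n}. v i \<oplus>\<^bsub>R\<^esub> w i)"
  "a \<odot>\<^bsub>free_mod R n\<^esub> v = (\<lambda>i\<in>{..<n}. a \<otimes>\<^bsub>R\<^esub> v i)"
  by (simp_all add: free_mod_def)

text \<open>Gluing over disjoint open and closed sets. Weighting the two pairs of maps by
  \<open>g\<close> and \<open>h\<close> kills the mixed terms, since the product of \<open>g\<close>
  and \<open>h\<close> is zero. The surviving terms carry the cubes of \<open>g\<close> and
  \<open>h\<close>, which idempotence turns back into \<open>g\<close> and \<open>h\<close>.\<close>

lemma iso_upto_add_orthogonal:
  assumes "module R M" "module R N" "iso_upto R g M N" "iso_upto R h M N"
    and "g \<otimes>\<^bsub>R\<^esub> g = g" "h \<otimes>\<^bsub>R\<^esub> h = h" "g \<otimes>\<^bsub>R\<^esub> h = \<zero>\<^bsub>R\<^esub>"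
  shows "iso_upto R (g \<oplus>\<^bsub>R\<^esub> h) M N"
proof -
  interpret M: module R M by fact
  interpret N: module R N by fact
  obtain \<phi> \<psi> where 1: "g \<in> carrier R" "mod_hom R M N \<phi>" "mod_hom R N M \<psi>"
    "\<And>x. x \<in> carrier M \<Longrightarrow> \<psi> (\<phi> x) = g \<odot>\<^bsub>M\<^esub> x"
    "\<And>y. y \<in> carrier N \<Longrightarrow> \<phi> (\<psi> y) = g \<odot>\<^bsub>N\<^esub> y"
    using assms(3) by (rule iso_uptoE) blast
  obtain \<phi>' \<psi>' where 2: "h \<in> carrier R" "mod_hom R M N \<phi>'" "mod_hom R N M \<psi>'"
    "\<And>x. x \<in> carrier M \<Longrightarrow> \<psi>' (\<phi>' x) = h \<odot>\<^bsub>M\<^esub> x"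
    "\<And>y. y \<in> carrier N \<Longrightarrow> \<phi>' (\<psi>' y) = h \<odot>\<^bsub>N\<^esub> y"
    using assms(4) by (rule iso_uptoE) blast
  have hg: "h \<otimes>\<^bsub>R\<^esub> g = \<zero>\<^bsub>R\<^esub>" using assms(7) 1 2 by (simp add: M.R.m_comm)
  note c = 1(1) 2(1) 1(4,5) 2(4,5) mod_homD[OF 1(2)] mod_homD[OF 1(3)] mod_homD[OF 2(2)]
    mod_homD[OF 2(3)] assms(5-7) hg
  show ?thesis
  proof (rule iso_uptoI)
    show "mod_hom R M N (\<lambda>x. g \<odot>\<^bsub>N\<^esub> \<phi> x \<oplus>\<^bsub>N\<^esub> h \<odot>\<^bsub>N\<^esub> \<phi>' x)"
      by (intro mod_hom_add mod_hom_smult assms(2) 1 2)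
    show "mod_hom R N M (\<lambda>x. g \<odot>\<^bsub>M\<^esub> \<psi> x \<oplus>\<^bsub>M\<^esub> h \<odot>\<^bsub>M\<^esub> \<psi>' x)"
      by (intro mod_hom_add mod_hom_smult assms(1) 1 2)
    show "g \<odot>\<^bsub>M\<^esub> \<psi> (g \<odot>\<^bsub>N\<^esub> \<phi> x \<oplus>\<^bsub>N\<^esub> h \<odot>\<^bsub>N\<^esub> \<phi>' x) \<oplus>\<^bsub>M\<^esub>
        h \<odot>\<^bsub>M\<^esub> \<psi>' (g \<odot>\<^bsub>N\<^esub> \<phi> x \<oplus>\<^bsub>N\<^esub> h \<odot>\<^bsub>N\<^esub> \<phi>' x) = (g \<oplus>\<^bsub>R\<^esub> h) \<odot>\<^bsub>M\<^esub> x"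
      if "x \<in> carrier M" for x
      using that by (simp add: c M.smult_r_distr M.smult_l_distr M.smult_assoc1[symmetric])
    show "g \<odot>\<^bsub>N\<^esub> \<phi> (g \<odot>\<^bsub>M\<^esub> \<psi> y \<oplus>\<^bsub>M\<^esub> h \<odot>\<^bsub>M\<^esub> \<psi>' y) \<oplus>\<^bsub>N\<^esub>
        h \<odot>\<^bsub>N\<^esub> \<phi>' (g \<odot>\<^bsub>M\<^esub> \<psi> y \<oplus>\<^bsub>M\<^esub> h \<odot>\<^bsub>M\<^esub> \<psi>' y) = (g \<oplus>\<^bsub>R\<^esub> h) \<odot>\<^bsub>N\<^esub> y"
      if "y \<in> carrier N" for y
      using that by (simp add: c N.smult_r_distr N.smult_l_distr N.smult_assoc1[symmetric])
  qed (simp add: c)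
qed

lemma free_mod_module:
  assumes "cring R"
  shows "module R (free_mod R n)"
proof -
  interpret cring R by fact
  show ?thesis
  proof (intro moduleI abelian_groupI)
    fix v assume v: "v \<in> carrier (free_mod R n)"
    show "\<exists>w\<in>carrier (free_mod R n). w \<oplus>\<^bsub>free_mod R n\<^esub> v = \<zero>\<^bsub>free_mod R n\<^esub>"
      using v by (intro bexI[of _ "\<lambda>i\<in>{..<n}. \<ominus>\<^bsub>R\<^esub> v i"]) (auto simp: l_neg PiE_iff intro!: restrict_ext)
    show "\<zero>\<^bsub>free_mod R n\<^esub> \<oplus>\<^bsub>free_mod R n\<^esub> v = v" "\<one>\<^bsub>R\<^esub> \<odot>\<^bsub>free_mod R n\<^esub> v = v"
      using v by (auto simp: PiE_iff extensional_def fun_eq_iff)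
  qed (use assms in \<open>auto simp: PiE_iff l_distr r_distr a_assoc m_assoc intro!: restrict_ext a_comm\<close>)
qed

lemma free_mod_add:
  assumes "cring R"
  shows "iso_upto R \<one>\<^bsub>R\<^esub> (dsum (free_mod R m) (free_mod R n)) (free_mod R (m + n))"
proof -
  interpret cring R by fact
  let ?\<psi> = "\<lambda>v. (\<lambda>i\<in>{..<m}. v i, \<lambda>i\<in>{..<n}. v (m + i))"
  let ?\<phi> = "\<lambda>(v, w). \<lambda>i\<in>{..<m+n}. if i < m then v i else w (i - m)"
  have shift: "i - m < n" if "i < m + n" "\<not> i < m" for i using that by linarith
  have \<phi>: "mod_hom R (dsum (free_mod R m) (free_mod R n)) (free_mod R (m + n)) ?\<phi>"
    by (rule mod_homI) (auto simp: PiE_iff shift intro!: restrict_ext)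
  have \<psi>: "mod_hom R (free_mod R (m + n)) (dsum (free_mod R m) (free_mod R n)) ?\<psi>"
    by (rule mod_homI) (auto simp: PiE_iff intro!: restrict_ext)
  show ?thesis
    by (rule iso_uptoI[OF one_closed \<phi> \<psi>]) (auto simp: PiE_iff extensional_def fun_eq_iff)
qed

section \<open>Projective modules as direct summands of free modules\<close>

lemma image_of_idempotent:
  assumes "module R F" "mod_hom R F F \<pi>" "\<And>x. x \<in> carrier F \<Longrightarrow> \<pi> (\<pi> x) = \<pi> x"
  shows "module R (F\<lparr>carrier := \<pi> ` carrier F\<rparr>)"
proof -
  interpret F: module R F by fact
  note h = mod_homD[OF assms(2)]
  have "submodule (\<pi> ` carrier F) R F"
  proof (rule F.submoduleI)
    show "\<zero>\<^bsub>F\<^esub> \<in> \<pi> ` carrier F"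
      by (metis mod_hom_zero[OF assms(1,1,2)] F.M.zero_closed image_eqI)
    show "\<ominus>\<^bsub>F\<^esub> a \<in> \<pi> ` carrier F" if "a \<in> \<pi> ` carrier F" for a
    proof -
      from that obtain x where x: "x \<in> carrier F" "a = \<pi> x" by auto
      have "\<ominus>\<^bsub>F\<^esub> a = (\<ominus>\<^bsub>R\<^esub> \<one>\<^bsub>R\<^esub>) \<odot>\<^bsub>F\<^esub> a"
        using x h(1) by (simp add: F.smult_l_minus)
      also have "\<dots> = \<pi> ((\<ominus>\<^bsub>R\<^esub> \<one>\<^bsub>R\<^esub>) \<odot>\<^bsub>F\<^esub> x)" using x by (simp add: h)
      finally show ?thesis using x by blast
    qed
    show "a \<oplus>\<^bsub>F\<^esub> b \<in> \<pi> ` carrier F" if "a \<in> \<pi> ` carrier F" "b \<in> \<pi> ` carrier F" for a b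
      using that by (auto simp: h(2)[symmetric])
    show "a \<odot>\<^bsub>F\<^esub> x \<in> \<pi> ` carrier F" if "a \<in> carrier R" "x \<in> \<pi> ` carrier F" for a x
      using that by (auto simp: h(3)[symmetric])
  qed (use h(1) in auto)
  from submodule.submodule_is_module[OF this assms(1)] show ?thesis .
qed

text \<open>If \<open>p\<close> retracts the section \<open>s\<close>, then \<open>s\<close> after
  \<open>p\<close> is an idempotent endomorphism \<pi> of R^n. Its image is a copy \<open>X\<close>
  of \<open>M\<close>, and the image of 1 - \<pi> is a complement. Both images live in R^n, so they
  have the carrier type over which \<open>refinement_ring\<close> quantifies, whatever the type of
  \<open>M\<close>.\<close>

lemma fg_projective_complement:
  fixes R :: "('a, 'r) ring_scheme" and M :: "('a, 'm) module"
  assumes "fg_projective R M"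
  obtains n and X Y :: "('a, nat \<Rightarrow> 'a) module"
  where "fg_projective R X" "fg_projective R Y" "iso_upto R \<one>\<^bsub>R\<^esub> M X"
    "iso_upto R \<one>\<^bsub>R\<^esub> (dsum X Y) (free_mod R n)"
proof -
  interpret M: module R M using assms by (simp add: fg_projective_def)
  obtain n p s where ps: "mod_hom R (free_mod R n) M p" "mod_hom R M (free_mod R n) s"
    "\<And>x. x \<in> carrier M \<Longrightarrow> p (s x) = x"
    using assms unfolding fg_projective_def by blast
  define F where "F = free_mod R n"
  define \<pi> where "\<pi> = (\<lambda>v. s (p v))"
  \<comment> \<open>The complementary projection 1 - \<pi>. Writing the difference with the scalar
    -1 makes it a homomorphism by closure under sums and scalar multiples.\<close>
  define \<kappa> where "\<kappa> = (\<lambda>v. v \<oplus>\<^bsub>F\<^esub> (\<ominus>\<^bsub>R\<^esub> \<one>\<^bsub>R\<^esub>) \<odot>\<^bsub>F\<^esub> \<pi> v)"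
  define X where "X = F\<lparr>carrier := \<pi> ` carrier F\<rparr>"
  define Y where "Y = F\<lparr>carrier := \<kappa> ` carrier F\<rparr>"
  have F: "module R F" unfolding F_def by (rule free_mod_module[OF M.R.cring_axioms])
  interpret F: module R F by fact
  have p: "mod_hom R F M p" and s: "mod_hom R M F s" using ps by (auto simp: F_def)
  have \<pi>: "mod_hom R F F \<pi>" unfolding \<pi>_def using mod_hom_comp[OF p s] .
  have "mod_hom R F F (\<lambda>x. x)" by (simp add: mod_homI)
  from mod_hom_add[OF F this mod_hom_smult[OF F \<pi>]] have \<kappa>: "mod_hom R F F \<kappa>"
    unfolding \<kappa>_def by simp
  note hp = mod_homD[OF p] and hs = mod_homD[OF s] and h\<pi> = mod_homD[OF \<pi>] and h\<kappa> = mod_homD[OF \<kappa>]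
  have \<pi>\<pi>: "\<pi> (\<pi> v) = \<pi> v" if "v \<in> carrier F" for v
    using that by (simp add: \<pi>_def ps(3) hp)
  have cancel: "v \<oplus>\<^bsub>F\<^esub> (\<ominus>\<^bsub>R\<^esub> \<one>\<^bsub>R\<^esub>) \<odot>\<^bsub>F\<^esub> v = \<zero>\<^bsub>F\<^esub>" if "v \<in> carrier F" for v
    using that by (simp add: F.smult_l_minus F.M.r_neg)
  have \<pi>\<kappa>: "\<pi> (\<kappa> v) = \<zero>\<^bsub>F\<^esub>" if "v \<in> carrier F" for v
    using that by (simp add: \<kappa>_def h\<pi> \<pi>\<pi> cancel)
  have \<kappa>\<kappa>: "\<kappa> (\<kappa> v) = \<kappa> v" if "v \<in> carrier F" for v
    using that h\<kappa>(1)[OF that] by (simp add: \<kappa>_def[THEN fun_cong, of "\<kappa> v"] \<pi>\<kappa>)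
  have \<kappa>\<pi>: "\<kappa> (\<pi> v) = \<zero>\<^bsub>F\<^esub>" if "v \<in> carrier F" for v
    using that by (simp add: \<kappa>_def h\<pi> \<pi>\<pi> cancel)
  have sum: "\<pi> v \<oplus>\<^bsub>F\<^esub> \<kappa> v = v" if "v \<in> carrier F" for v
  proof -
    have "\<pi> v \<oplus>\<^bsub>F\<^esub> \<kappa> v = v \<oplus>\<^bsub>F\<^esub> (\<pi> v \<oplus>\<^bsub>F\<^esub> (\<ominus>\<^bsub>R\<^esub> \<one>\<^bsub>R\<^esub>) \<odot>\<^bsub>F\<^esub> \<pi> v)"
      using that by (simp add: \<kappa>_def h\<pi> F.M.a_lcomm)
    then show ?thesis using that by (simp add: cancel h\<pi>)
  qed
  have XY: "module R X" "module R Y"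
    unfolding X_def Y_def using image_of_idempotent[OF F \<pi> \<pi>\<pi>] image_of_idempotent[OF F \<kappa> \<kappa>\<kappa>] by auto
  have sp\<pi>: "s (p (\<pi> v)) = \<pi> v" if "v \<in> carrier F" for v
    using \<pi>\<pi>[OF that] unfolding \<pi>_def .
  have sM: "s x \<in> \<pi> ` carrier F" if "x \<in> carrier M" for x
    using that by (intro image_eqI[of _ _ "s x"]) (simp_all add: \<pi>_def hs ps(3))
  have "fg_projective R X"
    unfolding fg_projective_def F_def[symmetric]
    by (intro conjI XY exI[of _ n] exI[of _ \<pi>] exI[of _ "\<lambda>x. x"])
      (auto simp: X_def F_def[symmetric] h\<pi> \<pi>\<pi> intro!: mod_homI)
  moreover have "fg_projective R Y"
    unfolding fg_projective_def
    by (intro conjI XY exI[of _ n] exI[of _ \<kappa>] exI[of _ "\<lambda>x. x"])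
      (auto simp: Y_def F_def[symmetric] h\<kappa> \<kappa>\<kappa> simp del: free_mod_simps intro!: mod_homI)
  moreover have "iso_upto R \<one>\<^bsub>R\<^esub> M X"
    by (rule iso_uptoI[where \<phi> = s and \<psi> = p])
      (auto simp: X_def hs hp ps(3) sM h\<pi> sp\<pi> intro!: mod_homI)
  moreover have "iso_upto R \<one>\<^bsub>R\<^esub> (dsum X Y) F"
  proof (rule iso_uptoI[where \<phi> = "\<lambda>(x, y). x \<oplus>\<^bsub>F\<^esub> y" and \<psi> = "\<lambda>v. (\<pi> v, \<kappa> v)"])
    show "mod_hom R (dsum X Y) F (\<lambda>(x, y). x \<oplus>\<^bsub>F\<^esub> y)"
      by (rule mod_homI) (auto simp: X_def Y_def h\<pi> h\<kappa> F.M.add.m_ac F.smult_r_distr)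
    show "mod_hom R F (dsum X Y) (\<lambda>v. (\<pi> v, \<kappa> v))"
      by (rule mod_homI) (auto simp: X_def Y_def h\<pi> h\<kappa>)
  qed (auto simp: X_def Y_def h\<pi> h\<kappa> \<pi>\<pi> \<kappa>\<kappa> \<pi>\<kappa> \<kappa>\<pi> sum)
  ultimately show ?thesis using that[of X Y n] by (simp add: F_def)
qed

text \<open>With inclusion \<phi> of \<open>X\<close> into R and projection \<psi> back, \<phi>
  after \<psi> is an endomorphism of R, hence multiplication by the image \<open>e\<close> of 1. As
  \<psi> after \<phi> is the identity, \<open>e\<close> acts as 1 on \<open>X\<close>. So
  \<open>e\<close> is idempotent, \<open>X\<close> is a copy of eR, and 1 - \<open>e\<close>
  annihilates \<open>X\<close>, which makes \<open>X\<close> free of rank 0 there.\<close>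

lemma rank_one_summand:
  assumes "cring R" "module R X" "module R Y"
    and "iso_upto R \<one>\<^bsub>R\<^esub> (dsum X Y) (free_mod R 1)"
  obtains e where "e \<in> carrier R" "e \<otimes>\<^bsub>R\<^esub> e = e"
    "iso_upto R e X (free_mod R 1)" "iso_upto R (\<one>\<^bsub>R\<^esub> \<ominus>\<^bsub>R\<^esub> e) X (free_mod R 0)"
proof -
  interpret cring R by fact
  interpret X: module R X by fact
  interpret Y: module R Y by fact
  let ?F = "free_mod R 1"
  interpret F: module R ?F by (rule free_mod_module[OF assms(1)])
  obtain f h where f: "mod_hom R (dsum X Y) ?F f" and h: "mod_hom R ?F (dsum X Y) h"
    and hf: "\<And>z. z \<in> carrier (dsum X Y) \<Longrightarrow> h (f z) = \<one>\<^bsub>R\<^esub> \<odot>\<^bsub>dsum X Y\<^esub> z"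
    using assms(4) by (rule iso_uptoE) blast
  have i: "mod_hom R X (dsum X Y) (\<lambda>x. (x, \<zero>\<^bsub>Y\<^esub>))" by (rule mod_homI) auto
  have q: "mod_hom R (dsum X Y) X fst" by (rule mod_homI) auto
  define \<phi> where "\<phi> = (\<lambda>x. f (x, \<zero>\<^bsub>Y\<^esub>))"
  define \<psi> where "\<psi> = (\<lambda>v. fst (h v))"
  have \<phi>: "mod_hom R X ?F \<phi>" unfolding \<phi>_def by (rule mod_hom_comp[OF i f])
  have \<psi>: "mod_hom R ?F X \<psi>" unfolding \<psi>_def by (rule mod_hom_comp[OF h q])
  have \<psi>\<phi>: "\<psi> (\<phi> x) = x" if "x \<in> carrier X" for x
    using that by (simp add: \<phi>_def \<psi>_def hf)
  define u where "u = (\<lambda>i\<in>{..<1::nat}. \<one>\<^bsub>R\<^esub>)"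
  have u: "u \<in> carrier ?F" by (auto simp: u_def)
  define e where "e = \<phi> (\<psi> u) 0"
  have \<phi>\<psi>u: "\<phi> (\<psi> u) \<in> carrier ?F" using u by (simp add: mod_homD[OF \<phi>] mod_homD[OF \<psi>] del: free_mod_simps One_nat_def)
  then have e: "e \<in> carrier R" by (auto simp: e_def)
  have \<phi>\<psi>: "\<phi> (\<psi> v) = e \<odot>\<^bsub>?F\<^esub> v" if v: "v \<in> carrier ?F" for v
  proof -
    have v0: "v 0 \<in> carrier R" using v by auto
    have "v = v 0 \<odot>\<^bsub>?F\<^esub> u" using v v0 by (auto simp: u_def PiE_iff extensional_def fun_eq_iff)
    then have "\<phi> (\<psi> v) = v 0 \<odot>\<^bsub>?F\<^esub> \<phi> (\<psi> u)"
      using v0 u by (metis mod_homD(1,3)[OF \<psi>] mod_homD(3)[OF \<phi>])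
    also have "\<dots> = e \<odot>\<^bsub>?F\<^esub> v"
      using v0 e by (auto simp: e_def m_comm intro!: restrict_ext)
    finally show ?thesis .
  qed
  have ex: "e \<odot>\<^bsub>X\<^esub> x = x" if "x \<in> carrier X" for x
  proof -
    have "\<psi> (\<phi> (\<psi> (\<phi> x))) = e \<odot>\<^bsub>X\<^esub> \<psi> (\<phi> x)"
      using that e mod_homD(1)[OF \<phi>] by (subst \<phi>\<psi>) (simp_all add: mod_homD[OF \<psi>] del: free_mod_simps One_nat_def)
    then show ?thesis using that by (simp add: \<psi>\<phi>)
  qed
  have "e \<otimes>\<^bsub>R\<^esub> e = e"
  proof -
    have "e \<odot>\<^bsub>?F\<^esub> \<phi> (\<psi> u) = \<phi> (\<psi> u)"
      using ex[OF mod_homD(1)[OF \<psi> u]] mod_homD(3)[OF \<phi> e mod_homD(1)[OF \<psi> u]] by metis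
    from fun_cong[OF this, of 0] show ?thesis by (simp add: e_def)
  qed
  moreover have "iso_upto R e X ?F"
    by (rule iso_uptoI[OF e \<phi> \<psi>]) (auto simp: \<psi>\<phi> \<phi>\<psi> ex simp del: free_mod_simps One_nat_def)
  moreover have "iso_upto R (\<one>\<^bsub>R\<^esub> \<ominus>\<^bsub>R\<^esub> e) X (free_mod R 0)"
  \<comment> \<open>The constantly undefined function is the only element of
    \<open>free_mod R 0\<close>, since an extensional function on the empty index set has no other
    values.\<close>
  proof (rule iso_uptoI[where \<phi> = "\<lambda>_. \<lambda>_. undefined" and \<psi> = "\<lambda>_. \<zero>\<^bsub>X\<^esub>"])
    show "\<zero>\<^bsub>X\<^esub> = (\<one>\<^bsub>R\<^esub> \<ominus>\<^bsub>R\<^esub> e) \<odot>\<^bsub>X\<^esub> x" if "x \<in> carrier X" for x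
      using that e by (simp add: a_minus_def X.smult_l_distr X.smult_l_minus ex X.M.r_neg)
  qed (use e in \<open>auto intro!: mod_homI\<close>)
  ultimately show ?thesis using that e by blast
qed

section \<open>Local freeness over refinement rings\<close>

lemma free_mod_fg_projective:
  assumes "cring R"
  shows "fg_projective R (free_mod R n)"
  unfolding fg_projective_def
  by (intro conjI free_mod_module[OF assms] exI[of _ n] exI[of _ "\<lambda>x. x"]) (auto intro!: mod_homI simp del: free_mod_simps)

text \<open>Induction on \<open>n\<close>, splitting off one coordinate of R^(n+1) at a time. The
  complement \<open>Y\<close> is part of the statement because the refinement has to be applied
  again to a summand together with its own complement.\<close>

lemma refinement_ring_locally_free:
  fixes R :: "('a, 'r) ring_scheme" and X Y :: "('a, nat \<Rightarrow> 'a) module"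
  assumes "refinement_ring R" "primeideal P R"
    and "fg_projective R X" "fg_projective R Y" "iso_upto R \<one>\<^bsub>R\<^esub> (dsum X Y) (free_mod R n)"
  shows "\<exists>g r. g \<in> carrier R \<and> g \<otimes>\<^bsub>R\<^esub> g = g \<and> g \<notin> P \<and> iso_upto R g X (free_mod R r)"
proof -
  interpret P: primeideal P R by fact
  have R: "cring R" by (rule P.cring_axioms)
  note free = free_mod_module[OF R]
  have one: "\<one>\<^bsub>R\<^esub> \<notin> P"
    using P.I_notcarr P.one_imp_carrier by blast
  show ?thesis
    using assms(3-5)
  proof (induction n arbitrary: X Y)
    case 0
    interpret X: module R X using 0 by (simp add: fg_projective_def)
    interpret Y: module R Y using 0 by (simp add: fg_projective_def)
    obtain f h where f: "mod_hom R (dsum X Y) (free_mod R 0) f"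
      and hf: "\<And>z. z \<in> carrier (dsum X Y) \<Longrightarrow> h (f z) = \<one>\<^bsub>R\<^esub> \<odot>\<^bsub>dsum X Y\<^esub> z"
      using 0(3) by (rule iso_uptoE) blast
    \<comment> \<open>The free module of rank 0 has one element, so \<open>f\<close> is constant;
      having the left inverse \<open>h\<close>, it is also injective.\<close>
    have X0: "x = \<zero>\<^bsub>X\<^esub>" if "x \<in> carrier X" for x
    proof -
      have "f (x, \<zero>\<^bsub>Y\<^esub>) = f (\<zero>\<^bsub>X\<^esub>, \<zero>\<^bsub>Y\<^esub>)"
        using mod_homD(1)[OF f, of "(x, \<zero>\<^bsub>Y\<^esub>)"] mod_homD(1)[OF f, of "(\<zero>\<^bsub>X\<^esub>, \<zero>\<^bsub>Y\<^esub>)"] that by simp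
      moreover have "h (f (y, \<zero>\<^bsub>Y\<^esub>)) = (y, \<zero>\<^bsub>Y\<^esub>)" if "y \<in> carrier X" for y
        using hf[of "(y, \<zero>\<^bsub>Y\<^esub>)"] that by simp
      ultimately show ?thesis using that X.M.zero_closed by (metis prod.inject)
    qed
    have "iso_upto R \<one>\<^bsub>R\<^esub> X (free_mod R 0)"
    proof (rule iso_uptoI[where \<phi> = "\<lambda>_. \<lambda>_. undefined" and \<psi> = "\<lambda>_. \<zero>\<^bsub>X\<^esub>"])
      show "\<zero>\<^bsub>X\<^esub> = \<one>\<^bsub>R\<^esub> \<odot>\<^bsub>X\<^esub> x" if "x \<in> carrier X" for x
        using X0[OF that] that by simp
    qed (auto intro!: mod_homI)
    with one show ?case by (intro exI[of _ "\<one>\<^bsub>R\<^esub>"] exI[of _ 0]) simp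
  next
    case (Suc n)
    have XY: "module R X" "module R Y" using Suc.prems by (auto simp: fg_projective_def)
    have "iso_upto R \<one>\<^bsub>R\<^esub> (free_mod R (Suc n)) (dsum (free_mod R n) (free_mod R 1))"
      using iso_upto_sym[OF free_mod_add[OF R, of n 1]] by simp
    from iso_upto_trans[OF dsum_module[OF XY] free dsum_module[OF free free] Suc.prems(3) this]
    have "mod_iso R (dsum X Y) (dsum (free_mod R n) (free_mod R 1))"
      by (subst mod_iso_iff_iso_upto_one) (simp_all add: dsum_module free XY)
    then have "fg_projective R X \<and> fg_projective R Y \<and> fg_projective R (free_mod R n) \<and>
        fg_projective R (free_mod R 1) \<and> mod_iso R (dsum X Y) (dsum (free_mod R n) (free_mod R 1))"
      using Suc.prems(1,2) free_mod_fg_projective[OF R] by blast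
    \<comment> \<open>In the refining square, \<open>X\<close> is the row \<open>Z11\<close>,
      \<open>Z12\<close>, and the columns are R^n and R. Thus \<open>Z11\<close> is a summand of R^n
      with complement \<open>Z21\<close>, ready for the induction hypothesis, and \<open>Z12\<close>
      is a summand of R with complement \<open>Z22\<close>.\<close>
    from assms(1)[unfolded refinement_ring_def, rule_format, OF this]
    obtain Z11 Z12 Z21 Z22 :: "('a, nat \<Rightarrow> 'a) module" where
      Z: "fg_projective R Z11" "fg_projective R Z12" "fg_projective R Z21" "fg_projective R Z22"
      and iso: "mod_iso R X (dsum Z11 Z12)" "mod_iso R (free_mod R n) (dsum Z11 Z21)"
        "mod_iso R (free_mod R 1) (dsum Z12 Z22)"
      by blast
    have M: "module R Z11" "module R Z12" "module R Z21" "module R Z22"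
      using Z by (auto simp: fg_projective_def)
    have iso': "iso_upto R \<one>\<^bsub>R\<^esub> X (dsum Z11 Z12)" "iso_upto R \<one>\<^bsub>R\<^esub> (dsum Z11 Z21) (free_mod R n)"
        "iso_upto R \<one>\<^bsub>R\<^esub> (dsum Z12 Z22) (free_mod R 1)"
      using iso by (auto simp: mod_iso_iff_iso_upto_one dsum_module free XY M intro: iso_upto_sym)
    obtain g r where g: "g \<in> carrier R" "g \<otimes>\<^bsub>R\<^esub> g = g" "g \<notin> P" "iso_upto R g Z11 (free_mod R r)"
      using Suc.IH[OF Z(1,3) iso'(2)] by blast
    obtain e where e: "e \<in> carrier R" "e \<otimes>\<^bsub>R\<^esub> e = e"
      "iso_upto R e Z12 (free_mod R 1)" "iso_upto R (\<one>\<^bsub>R\<^esub> \<ominus>\<^bsub>R\<^esub> e) Z12 (free_mod R 0)"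
      using rank_one_summand[OF R M(2,4) iso'(3)] by blast
    \<comment> \<open>\<open>Z12\<close> is free of rank 1 over \<open>e\<close> and of rank 0 over
      1 - \<open>e\<close>; these add up to 1, so \<open>P\<close> cannot contain both.\<close>
    have "\<exists>h k. h \<in> carrier R \<and> h \<otimes>\<^bsub>R\<^esub> h = h \<and> h \<notin> P \<and> iso_upto R h Z12 (free_mod R k)"
    proof (cases "e \<in> P")
      case True
      have "(\<one>\<^bsub>R\<^esub> \<ominus>\<^bsub>R\<^esub> e) \<oplus>\<^bsub>R\<^esub> e = \<one>\<^bsub>R\<^esub>"
        using e(1) by (simp add: a_minus_def P.a_assoc P.l_neg)
      then have "\<one>\<^bsub>R\<^esub> \<ominus>\<^bsub>R\<^esub> e \<notin> P" using True one additive_subgroup.a_closed[OF P.is_additive_subgroup] by metis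
      moreover have "(\<one>\<^bsub>R\<^esub> \<ominus>\<^bsub>R\<^esub> e) \<otimes>\<^bsub>R\<^esub> (\<one>\<^bsub>R\<^esub> \<ominus>\<^bsub>R\<^esub> e) = \<one>\<^bsub>R\<^esub> \<ominus>\<^bsub>R\<^esub> e"
        using e(1,2) by (simp add: a_minus_def P.l_distr P.r_distr P.l_minus P.r_minus P.a_assoc P.r_neg1 P.r_neg2 P.r_neg P.l_neg)
      ultimately show ?thesis using e by (intro exI[of _ "\<one>\<^bsub>R\<^esub> \<ominus>\<^bsub>R\<^esub> e"] exI[of _ 0]) simp
    qed (use e in blast)
    then obtain h k where h: "h \<in> carrier R" "h \<otimes>\<^bsub>R\<^esub> h = h" "h \<notin> P" "iso_upto R h Z12 (free_mod R k)"
      by blast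
    have hg: "h \<otimes>\<^bsub>R\<^esub> g = g \<otimes>\<^bsub>R\<^esub> h" using g h by (simp add: P.m_comm)
    have "iso_upto R (g \<otimes>\<^bsub>R\<^esub> h) (dsum Z11 Z12) (dsum (free_mod R r) (free_mod R k))"
      using iso_upto_mult[OF M(1) free g(4) h(1,2)] iso_upto_mult[OF M(2) free h(4) g(1,2)]
      unfolding hg by (rule iso_upto_dsum)
    from iso_upto_trans[OF dsum_module[OF M(1,2)] dsum_module[OF free free] free this free_mod_add[OF R]]
    have "iso_upto R (g \<otimes>\<^bsub>R\<^esub> h) (dsum Z11 Z12) (free_mod R (r + k))"
      using g h by simp
    from iso_upto_trans[OF XY(1) dsum_module[OF M(1,2)] free iso'(1) this]
    have "iso_upto R (g \<otimes>\<^bsub>R\<^esub> h) X (free_mod R (r + k))"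
      using g h by simp
    moreover have "g \<otimes>\<^bsub>R\<^esub> h \<notin> P" using P.I_prime[OF g(1) h(1)] g h by blast
    moreover have "(g \<otimes>\<^bsub>R\<^esub> h) \<otimes>\<^bsub>R\<^esub> (g \<otimes>\<^bsub>R\<^esub> h) = g \<otimes>\<^bsub>R\<^esub> h"
    proof -
      have "(g \<otimes>\<^bsub>R\<^esub> h) \<otimes>\<^bsub>R\<^esub> (g \<otimes>\<^bsub>R\<^esub> h) = (g \<otimes>\<^bsub>R\<^esub> g) \<otimes>\<^bsub>R\<^esub> (h \<otimes>\<^bsub>R\<^esub> h)"
        using g(1) h(1) by (simp add: P.m_ac)
      then show ?thesis by (simp only: g h)
    qed
    ultimately show ?case using g h by (intro exI[of _ "g \<otimes>\<^bsub>R\<^esub> h"] exI[of _ "r + k"]) simp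
  qed
qed

section \<open>Invariance of rank modulo a prime\<close>

lemma (in ideal) finsum_in_ideal:
  assumes "finite A" "\<And>i. i \<in> A \<Longrightarrow> f i \<in> I"
  shows "(\<Oplus>i\<in>A. f i) \<in> I"
  using assms
proof (induction A rule: finite_induct)
  case (insert i A)
  then have "f \<in> A \<rightarrow> carrier R" "f i \<in> carrier R" using a_subset by auto
  with insert show ?case by simp
qed simp

text \<open>Gaussian elimination in which pivots are only required to lie outside the prime, so rows are
  cleared by cross-multiplication instead of division.\<close>

lemma (in primeideal) homogeneous_system_mod_prime:
  assumes "finite J" "finite K" "card J < card K"
    and "\<And>j i. j \<in> J \<Longrightarrow> i \<in> K \<Longrightarrow> a j i \<in> carrier R"
  shows "\<exists>v. (\<forall>i\<in>K. v i \<in> carrier R) \<and> (\<exists>i\<in>K. v i \<notin> I) \<and>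
    (\<forall>j\<in>J. (\<Oplus>i\<in>K. a j i \<otimes> v i) \<in> I)"
  using assms
proof (induction J arbitrary: K a rule: finite_induct)
  \<comment> \<open>Without equations any vector with an entry outside the ideal will do, and
    \<open>K\<close> is nonempty because its cardinality is positive.\<close>
  case empty
  have "\<one> \<notin> I" using I_notcarr one_imp_carrier by blast
  moreover obtain i where "i \<in> K" using empty by fastforce
  ultimately show ?case by (intro exI[of _ "\<lambda>_. \<one>"]) auto
next
  case (insert l J)
  note a = insert.prems(3)
  show ?case
  \<comment> \<open>Without a pivot, row \<open>l\<close> imposes no condition modulo
    \<open>I\<close> and is dropped. With a pivot, one equation and one unknown disappear together,
    which keeps the strict inequality of cardinalities.\<close>
  proof (cases "\<forall>i\<in>K. a l i \<in> I")
    case True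
    have "card J < card K" using insert by simp
    then obtain v where v: "\<forall>i\<in>K. v i \<in> carrier R" "\<exists>i\<in>K. v i \<notin> I"
      "\<forall>j\<in>J. (\<Oplus>i\<in>K. a j i \<otimes> v i) \<in> I"
      using insert.IH[of K a] insert.prems by blast
    moreover have "(\<Oplus>i\<in>K. a l i \<otimes> v i) \<in> I"
      using True v by (intro finsum_in_ideal insert.prems(1) I_r_closed) auto
    ultimately show ?thesis by blast
  next
    case False
    then obtain k where k: "k \<in> K" "a l k \<notin> I" by blast
    define c where "c = a l k"
    define K' where "K' = K - {k}"
    have K: "K = insert k K'" "k \<notin> K'" "finite K'" using k insert.prems(1) by (auto simp: K'_def)
    then have "card J < card K'" using insert by simp
    \<comment> \<open>Row \<open>j\<close> times the pivot \<open>c\<close>, minus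
      \<open>a j k\<close> times row \<open>l\<close>: the coefficient of the unknown
      \<open>k\<close> cancels.\<close>
    define b where "b = (\<lambda>j i. a j i \<otimes> c \<oplus> \<ominus> a j k \<otimes> a l i)"
    have c: "c \<in> carrier R" using a k by (simp add: c_def)
    obtain w where w: "\<forall>i\<in>K'. w i \<in> carrier R" "\<exists>i\<in>K'. w i \<notin> I"
      "\<forall>j\<in>J. (\<Oplus>i\<in>K'. b j i \<otimes> w i) \<in> I"
      using insert.IH[of K' b] \<open>card J < card K'\<close> a c K k by (auto simp: b_def)
    \<comment> \<open>Back substitution without division: the solution \<open>w\<close> is scaled by
      the pivot, and the entry at \<open>k\<close> is chosen so that row \<open>l\<close> becomes
      exactly 0. With this choice row \<open>j\<close> at \<open>v\<close> equals the reduced row at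
      \<open>w\<close>.\<close>
    define v where "v = (\<lambda>i. if i = k then \<ominus> (\<Oplus>i\<in>K'. a l i \<otimes> w i) else c \<otimes> w i)"
    have al: "a l i \<in> carrier R" if "i \<in> K'" for i using that a K by simp
    have S: "(\<Oplus>i\<in>K'. a l i \<otimes> w i) \<in> carrier R" using w al by (intro finsum_closed) auto
    have vK: "\<forall>i\<in>K. v i \<in> carrier R" using S w c K by (auto simp: v_def)
    have eq: "(\<Oplus>i\<in>K. a j i \<otimes> v i) = (\<Oplus>i\<in>K'. b j i \<otimes> w i)" if j: "j \<in> insert l J" for j
    proof -
      have aj: "a j i \<in> carrier R" if "i \<in> K" for i using a j that by blast
      have "(\<Oplus>i\<in>K'. b j i \<otimes> w i) = (\<Oplus>i\<in>K'. a j i \<otimes> v i \<oplus> \<ominus> a j k \<otimes> (a l i \<otimes> w i))"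
      proof (rule finsum_cong')
        fix i assume i: "i \<in> K'"
        then have "i \<noteq> k" using K by auto
        with i show "b j i \<otimes> w i = a j i \<otimes> v i \<oplus> \<ominus> a j k \<otimes> (a l i \<otimes> w i)"
          using w aj al c K by (simp add: b_def v_def l_distr m_assoc)
      qed (use vK aj al w K in auto)
      also have "\<dots> = (\<Oplus>i\<in>K'. a j i \<otimes> v i) \<oplus> (\<Oplus>i\<in>K'. \<ominus> a j k \<otimes> (a l i \<otimes> w i))"
        using vK aj al w K by (intro finsum_addf) auto
      also have "(\<Oplus>i\<in>K'. \<ominus> a j k \<otimes> (a l i \<otimes> w i)) = a j k \<otimes> v k"
        using aj al w K S by (subst finsum_rdistr[symmetric]) (auto simp: v_def l_minus r_minus)
      also have "(\<Oplus>i\<in>K'. a j i \<otimes> v i) \<oplus> a j k \<otimes> v k = (\<Oplus>i\<in>K. a j i \<otimes> v i)"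
        unfolding K(1) using vK aj K
        by (subst finsum_insert) (auto intro!: a_comm finsum_closed)
      finally show ?thesis by simp
    qed
    have "(\<Oplus>i\<in>K'. b l i \<otimes> w i) = (\<Oplus>i\<in>K'. \<zero>)"
      using al c w by (intro finsum_cong') (auto simp: b_def c_def[symmetric] l_minus m_comm r_neg)
    then have "(\<Oplus>i\<in>K'. b l i \<otimes> w i) \<in> I" by simp
    then have "\<forall>j\<in>insert l J. (\<Oplus>i\<in>K. a j i \<otimes> v i) \<in> I"
      using eq w(3) by simp
    moreover have "\<exists>i\<in>K. v i \<notin> I"
    proof -
      obtain i where i: "i \<in> K'" "w i \<notin> I" using w by blast
      then have "c \<otimes> w i \<notin> I" using I_prime[OF c, of "w i"] w k by (auto simp: c_def)
      with i K show ?thesis by (intro bexI[of _ i]) (auto simp: v_def)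
    qed
    ultimately show ?thesis using vK by blast
  qed
qed

section \<open>Coordinates and matrices of maps between free modules\<close>

definition unit_vec :: "('a, 'r) ring_scheme \<Rightarrow> nat \<Rightarrow> nat \<Rightarrow> nat \<Rightarrow> 'a" where
  "unit_vec R n i = (\<lambda>k\<in>{..<n}. if k = i then \<one>\<^bsub>R\<^esub> else \<zero>\<^bsub>R\<^esub>)"

lemma unit_vec_closed: "cring R \<Longrightarrow> unit_vec R n i \<in> carrier (free_mod R n)"
  by (auto simp: unit_vec_def cring.cring_simprules)

lemma free_mod_finsum_apply:
  assumes "cring R" "finite A" "f \<in> A \<rightarrow> carrier (free_mod R n)" "j < n"
  shows "finsum (free_mod R n) f A j = finsum R (\<lambda>i. f i j) A"
proof -
  interpret cring R by fact
  interpret F: module R "free_mod R n" by (rule free_mod_module[OF assms(1)])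
  show ?thesis
    using assms(2,3)
  proof (induction A rule: finite_induct)
    case empty
    then show ?case using assms(4) by (simp only: F.M.finsum_empty finsum_empty) simp
  next
    case (insert i A)
    then have f: "f \<in> A \<rightarrow> carrier (free_mod R n)" "f i \<in> carrier (free_mod R n)" by blast+
    have fj: "(\<lambda>i. f i j) \<in> A \<rightarrow> carrier R" "f i j \<in> carrier R"
      using f assms(4) by (auto simp: PiE_iff Pi_iff)
    have "finsum (free_mod R n) f (insert i A) = f i \<oplus>\<^bsub>free_mod R n\<^esub> finsum (free_mod R n) f A"
      by (rule F.M.finsum_insert[OF insert.hyps f])
    then show ?case
      using insert.IH[OF f(1)] finsum_insert[OF insert.hyps fj] assms(4) by simp
  qed
qed

lemma free_mod_expand:
  assumes "cring R" "x \<in> carrier (free_mod R n)"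
  shows "finsum (free_mod R n) (\<lambda>i. x i \<odot>\<^bsub>free_mod R n\<^esub> unit_vec R n i) {..<n} = x"
proof -
  interpret cring R by fact
  interpret F: module R "free_mod R n" by (rule free_mod_module[OF assms(1)])
  have x: "x i \<in> carrier R" if "i < n" for i using assms(2) that by (auto simp: PiE_iff)
  have c: "(\<lambda>i. x i \<odot>\<^bsub>free_mod R n\<^esub> unit_vec R n i) \<in> {..<n} \<rightarrow> carrier (free_mod R n)"
    using x unit_vec_closed[OF assms(1)] F.smult_closed by blast
  have s: "finsum (free_mod R n) (\<lambda>i. x i \<odot>\<^bsub>free_mod R n\<^esub> unit_vec R n i) {..<n} \<in> carrier (free_mod R n)"
    by (rule F.M.finsum_closed[OF c])
  show ?thesis
  proof
    fix j
    show "finsum (free_mod R n) (\<lambda>i. x i \<odot>\<^bsub>free_mod R n\<^esub> unit_vec R n i) {..<n} j = x j"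
    proof (cases "j < n")
      case True
      have "finsum R (\<lambda>i. (x i \<odot>\<^bsub>free_mod R n\<^esub> unit_vec R n i) j) {..<n} =
        (\<Oplus>\<^bsub>R\<^esub>i\<in>{..<n}. if j = i then x i else \<zero>\<^bsub>R\<^esub>)"
        using True x by (intro finsum_cong') (auto simp: unit_vec_def)
      also have "\<dots> = x j" using True x by (intro finsum_singleton) auto
      finally show ?thesis using free_mod_finsum_apply[OF assms(1) _ c True] by simp
    next
      \<comment> \<open>Beyond the index range both sides are \<open>undefined\<close>, as elements
        of a free module are extensional functions.\<close>
      case False
      then show ?thesis using s assms(2) by (simp add: PiE_iff extensional_def)
    qed
  qed
qed

text \<open>The scalars \<open>f (unit_vec R m i) j\<close> are the matrix entries of
  \<open>f\<close>. In this form the elimination over scalars applies to homomorphisms.\<close>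

lemma free_mod_hom_apply:
  assumes "cring R" "mod_hom R (free_mod R m) (free_mod R n) f" "x \<in> carrier (free_mod R m)" "j < n"
  shows "f x j = (\<Oplus>\<^bsub>R\<^esub>i\<in>{..<m}. f (unit_vec R m i) j \<otimes>\<^bsub>R\<^esub> x i)"
proof -
  interpret cring R by fact
  interpret F: module R "free_mod R m" by (rule free_mod_module[OF assms(1)])
  interpret G: module R "free_mod R n" by (rule free_mod_module[OF assms(1)])
  note u = unit_vec_closed[OF assms(1), of m]
  have x: "x i \<in> carrier R" if "i < m" for i using assms(3) that by (auto simp: PiE_iff)
  have fu: "f (unit_vec R m i) \<in> carrier (free_mod R n)" for i by (rule mod_homD(1)[OF assms(2) u])
  then have fuj: "f (unit_vec R m i) j \<in> carrier R" for i using assms(4) by (auto simp: PiE_iff)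
  have "f x = f (finsum (free_mod R m) (\<lambda>i. x i \<odot>\<^bsub>free_mod R m\<^esub> unit_vec R m i) {..<m})"
    by (simp only: free_mod_expand[OF assms(1,3)])
  also have "\<dots> = finsum (free_mod R n) (\<lambda>i. f (x i \<odot>\<^bsub>free_mod R m\<^esub> unit_vec R m i)) {..<m}"
    using x u F.smult_closed
    by (intro mod_hom_finsum[OF F.module_axioms G.module_axioms assms(2)]) blast+
  finally have "f x j = finsum (free_mod R n) (\<lambda>i. f (x i \<odot>\<^bsub>free_mod R m\<^esub> unit_vec R m i)) {..<m} j"
    by (rule fun_cong)
  also have "\<dots> = (\<Oplus>\<^bsub>R\<^esub>i\<in>{..<m}. f (x i \<odot>\<^bsub>free_mod R m\<^esub> unit_vec R m i) j)"
    using x u F.smult_closed mod_homD(1)[OF assms(2)]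
    by (intro free_mod_finsum_apply[OF assms(1) _ _ assms(4)]) blast+
  also have "\<dots> = (\<Oplus>\<^bsub>R\<^esub>i\<in>{..<m}. f (unit_vec R m i) j \<otimes>\<^bsub>R\<^esub> x i)"
  proof (rule finsum_cong')
    fix i assume "i \<in> {..<m}"
    with x have xi: "x i \<in> carrier R" by simp
    have "f (x i \<odot>\<^bsub>free_mod R m\<^esub> unit_vec R m i) = x i \<odot>\<^bsub>free_mod R n\<^esub> f (unit_vec R m i)"
      by (rule mod_homD(3)[OF assms(2) xi u])
    then show "f (x i \<odot>\<^bsub>free_mod R m\<^esub> unit_vec R m i) j = f (unit_vec R m i) j \<otimes>\<^bsub>R\<^esub> x i"
      using xi fuj assms(4) by (simp add: m_comm)
  qed (use x fuj in auto)
  finally show ?thesis .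
qed

text \<open>Invariance of dimension over the fraction field of R/P, without forming that field. If
  \<open>m\<close> exceeded \<open>n\<close>, the matrix of \<phi> would have a kernel vector
  \<open>v\<close> modulo \<open>P\<close> with an entry outside \<open>P\<close>. Applying \<psi>
  would put \<open>s\<close> times each entry of \<open>v\<close> into \<open>P\<close>, against
  primality.\<close>

lemma free_mod_rank_le:
  assumes "primeideal P R" "iso_upto R s (free_mod R m) (free_mod R n)" "s \<notin> P"
  shows "m \<le> n"
proof (rule ccontr)
  assume "\<not> m \<le> n"
  interpret P: primeideal P R by fact
  have R: "cring R" by (rule P.cring_axioms)
  obtain \<phi> \<psi> where 1: "s \<in> carrier R" "mod_hom R (free_mod R m) (free_mod R n) \<phi>"
    "mod_hom R (free_mod R n) (free_mod R m) \<psi>"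
    "\<And>x. x \<in> carrier (free_mod R m) \<Longrightarrow> \<psi> (\<phi> x) = s \<odot>\<^bsub>free_mod R m\<^esub> x"
    using assms(2) by (rule iso_uptoE) blast
  have \<phi>u: "\<phi> (unit_vec R m i) j \<in> carrier R" if "j < n" for i j
    using mod_homD(1)[OF 1(2) unit_vec_closed[OF R]] that by (auto simp: PiE_iff)
  have \<psi>u: "\<psi> (unit_vec R n i) j \<in> carrier R" if "j < m" for i j
    using mod_homD(1)[OF 1(3) unit_vec_closed[OF R]] that by (auto simp: PiE_iff)
  obtain v where v: "\<forall>i\<in>{..<m}. v i \<in> carrier R" "\<exists>i\<in>{..<m}. v i \<notin> P"
    "\<forall>j\<in>{..<n}. (\<Oplus>\<^bsub>R\<^esub>i\<in>{..<m}. \<phi> (unit_vec R m i) j \<otimes>\<^bsub>R\<^esub> v i) \<in> P"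
    using P.homogeneous_system_mod_prime[of "{..<n}" "{..<m}" "\<lambda>j i. \<phi> (unit_vec R m i) j"]
      \<phi>u \<open>\<not> m \<le> n\<close> by auto
  define x where "x = restrict v {..<m}"
  have x: "x \<in> carrier (free_mod R m)" using v by (auto simp: x_def)
  have \<phi>x: "\<phi> x j \<in> P" if "j < n" for j
  proof -
    have "(\<Oplus>\<^bsub>R\<^esub>i\<in>{..<m}. \<phi> (unit_vec R m i) j \<otimes>\<^bsub>R\<^esub> x i) =
      (\<Oplus>\<^bsub>R\<^esub>i\<in>{..<m}. \<phi> (unit_vec R m i) j \<otimes>\<^bsub>R\<^esub> v i)"
      using v \<phi>u[OF that] by (intro P.finsum_cong') (auto simp: x_def)
    with free_mod_hom_apply[OF R 1(2) x that] v(3) that show ?thesis by simp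
  qed
  obtain i where i: "i < m" "v i \<notin> P" using v by auto
  have "\<psi> (\<phi> x) i \<in> P"
    unfolding free_mod_hom_apply[OF R 1(3) mod_homD(1)[OF 1(2) x] i(1)]
    using \<phi>x \<psi>u[OF i(1)] by (intro P.finsum_in_ideal P.I_l_closed) auto
  moreover have "\<psi> (\<phi> x) i = s \<otimes>\<^bsub>R\<^esub> v i"
    unfolding 1(4)[OF x] using i by (simp add: x_def)
  ultimately have "s \<otimes>\<^bsub>R\<^esub> v i \<in> P" by simp
  then show False using P.I_prime[OF 1(1), of "v i"] v i assms(3) by auto
qed

section \<open>Localization\<close>

lemma (in primeideal) denominator_closed:
  shows "\<one> \<in> carrier R - I"
    and "s \<in> carrier R - I \<Longrightarrow> t \<in> carrier R - I \<Longrightarrow> s \<otimes> t \<in> carrier R - I"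
  using I_notcarr one_imp_carrier I_prime by auto

text \<open>Read \<open>Q i s\<close> as: \<open>s\<close> is an admissible denominator for
  \<open>i\<close>. Admissibility survives multiplication by elements outside the prime, so the
  product of finitely many individual choices serves for all.\<close>

lemma (in primeideal) common_denominator:
  assumes "finite A" "\<And>i. i \<in> A \<Longrightarrow> \<exists>s\<in>carrier R - I. Q i s"
    and "\<And>i s t. i \<in> A \<Longrightarrow> s \<in> carrier R - I \<Longrightarrow> t \<in> carrier R - I \<Longrightarrow> Q i s \<Longrightarrow> Q i (t \<otimes> s)"
  shows "\<exists>s\<in>carrier R - I. \<forall>i\<in>A. Q i s"
  using assms
proof (induction A rule: finite_induct)
  case empty
  then show ?case using denominator_closed by blast
next
  case (insert i A)
  have "\<exists>s\<in>carrier R - I. \<forall>i\<in>A. Q i s"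
    by (rule insert.IH[OF insert.prems(1)[OF insertI2] insert.prems(2)[OF insertI2]])
  then obtain s where s: "s \<in> carrier R - I" "\<forall>i\<in>A. Q i s" by blast
  obtain t where t: "t \<in> carrier R - I" "Q i t" using insert.prems(1)[OF insertI1] by blast
  have "s \<otimes> t = t \<otimes> s" using s t by (simp add: m_comm)
  then have "Q i (t \<otimes> s)" using insert.prems(2)[OF insertI1 t(1) s(1) t(2)] by simp
  moreover have "Q j (t \<otimes> s)" if "j \<in> A" for j
    using insert.prems(2)[OF insertI2[OF that] s(1) t(1)] s(2) that by blast
  ultimately have "\<forall>j\<in>insert i A. Q j (t \<otimes> s)" by blast
  then show ?case using denominator_closed(2)[OF t(1) s(1)] by blast
qed

lemma (in abelian_group) minus_eq_zero_iff:
  assumes "x \<in> carrier G" "y \<in> carrier G"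
  shows "x \<ominus> y = \<zero> \<longleftrightarrow> x = y"
proof
  assume "x \<ominus> y = \<zero>"
  then have "\<ominus> (\<ominus> y) = x" using assms by (intro minus_equality) (simp_all add: a_minus_def)
  then show "x = y" using assms by simp
qed (use assms in \<open>simp add: a_minus_def r_neg\<close>)

text \<open>The operations on fractions are unions over all pairs of representatives. When the
  result does not depend on the pair, the union over nonempty classes is that common result; so
  independence of representatives suffices to compute them.\<close>

lemma UN_UN_const:
  assumes "X \<noteq> {}" "Y \<noteq> {}"
    and "\<And>m s n t. (m, s) \<in> X \<Longrightarrow> (n, t) \<in> Y \<Longrightarrow> g m s n t = C"
  shows "(\<Union>(m, s)\<in>X. \<Union>(n, t)\<in>Y. g m s n t) = C"
proof -
  have "(\<Union>(n, t)\<in>Y. g m s n t) = C" if "(m, s) \<in> X" for m s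
    using assms(2) assms(3)[OF that] by (intro SUP_eq_const) auto
  then show ?thesis
    by (intro SUP_eq_const[OF assms(1)]) (simp only: split_paired_all split)
qed

section \<open>Calculating with fractions in M_P\<close>

lemma loc_ringE:
  assumes "A \<in> carrier (loc_ring R P)"
  obtains a s where "a \<in> carrier R" "s \<in> carrier R - P" "A = loc_class R P (a, s)"
  using assms by (auto simp: loc_ring_def)

lemma loc_class_closed:
  "a \<in> carrier R \<Longrightarrow> s \<in> carrier R - P \<Longrightarrow> loc_class R P (a, s) \<in> carrier (loc_ring R P)"
  by (auto simp: loc_ring_def)

locale localized_module = module R M + primeideal P R
  for R :: "('a, 'r) ring_scheme" (structure) and M :: "('a, 'm) module" (structure) and P
begin

abbreviation "frac m s \<equiv> locm_class R M P (m, s)"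

lemma den_closed: "s \<in> carrier R - P \<Longrightarrow> s \<in> carrier R"
  by simp

lemma locm_rel_iff:
  assumes "m \<in> carrier M" "n \<in> carrier M" "s \<in> carrier R - P" "t \<in> carrier R - P"
  shows "locm_rel R M P (m, s) (n, t) \<longleftrightarrow>
    (\<exists>u\<in>carrier R - P. (u \<otimes> t) \<odot>\<^bsub>M\<^esub> m = (u \<otimes> s) \<odot>\<^bsub>M\<^esub> n)"
proof -
  have "u \<odot>\<^bsub>M\<^esub> (t \<odot>\<^bsub>M\<^esub> m \<ominus>\<^bsub>M\<^esub> s \<odot>\<^bsub>M\<^esub> n) = \<zero>\<^bsub>M\<^esub> \<longleftrightarrow> (u \<otimes> t) \<odot>\<^bsub>M\<^esub> m = (u \<otimes> s) \<odot>\<^bsub>M\<^esub> n"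
    if "u \<in> carrier R - P" for u
  proof -
    have "u \<odot>\<^bsub>M\<^esub> (t \<odot>\<^bsub>M\<^esub> m \<ominus>\<^bsub>M\<^esub> s \<odot>\<^bsub>M\<^esub> n) = (u \<otimes> t) \<odot>\<^bsub>M\<^esub> m \<ominus>\<^bsub>M\<^esub> (u \<otimes> s) \<odot>\<^bsub>M\<^esub> n"
      using assms that by (simp add: a_minus_def smult_r_distr smult_r_minus smult_assoc1)
    then show ?thesis using assms that by (simp add: M.minus_eq_zero_iff)
  qed
  then show ?thesis unfolding locm_rel_def by simp
qed

lemma mem_frac_iff:
  assumes "m \<in> carrier M" "s \<in> carrier R - P"
  shows "(n, t) \<in> frac m s \<longleftrightarrow> n \<in> carrier M \<and> t \<in> carrier R - P \<and>
    (\<exists>u\<in>carrier R - P. (u \<otimes> s) \<odot>\<^bsub>M\<^esub> n = (u \<otimes> t) \<odot>\<^bsub>M\<^esub> m)"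
  using assms by (auto simp: locm_class_def locm_rel_iff)

text \<open>An equation is multiplied by \<open>c\<close>, with the products passed as the separate
  equations for \<open>a'\<close> and \<open>b'\<close>, so that the regrouping of factors takes
  place in the ring alone.\<close>

lemma smult_cancel_common:
  assumes "a \<odot>\<^bsub>M\<^esub> m = b \<odot>\<^bsub>M\<^esub> n" "c \<otimes> a = a'" "c \<otimes> b = b'"
    and "a \<in> carrier R" "b \<in> carrier R" "c \<in> carrier R" "m \<in> carrier M" "n \<in> carrier M"
  shows "a' \<odot>\<^bsub>M\<^esub> m = b' \<odot>\<^bsub>M\<^esub> n"
  using assms by (metis smult_assoc1)

text \<open>Transitivity of the fraction relation gives one inclusion of classes; its symmetry gives
  the other by exchanging the two fractions in \<open>sub\<close>.\<close>

lemma frac_eqI: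
  assumes "m \<in> carrier M" "n \<in> carrier M" "s \<in> carrier R - P" "t \<in> carrier R - P"
    and u: "u \<in> carrier R - P" "(u \<otimes> t) \<odot>\<^bsub>M\<^esub> m = (u \<otimes> s) \<odot>\<^bsub>M\<^esub> n"
  shows "frac m s = frac n t"
proof -
  have sub: "frac m s \<subseteq> frac n t"
    if mn: "m \<in> carrier M" "n \<in> carrier M" and st: "s \<in> carrier R - P" "t \<in> carrier R - P"
    and eq: "(u \<otimes> t) \<odot>\<^bsub>M\<^esub> m = (u \<otimes> s) \<odot>\<^bsub>M\<^esub> n" for m n s t
  proof
    fix q assume q: "q \<in> frac m s"
    obtain l r where [simp]: "q = (l, r)" by (cases q)
    from q obtain v where l: "l \<in> carrier M" "r \<in> carrier R - P" "v \<in> carrier R - P"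
      "(v \<otimes> s) \<odot>\<^bsub>M\<^esub> l = (v \<otimes> r) \<odot>\<^bsub>M\<^esub> m"
      using mn st by (auto simp: mem_frac_iff)
    \<comment> \<open>Besides the two witnesses \<open>u\<close> and \<open>v\<close>, the new
      witness contains \<open>s\<close>, the denominator of the middle fraction: neither equation
      can be chained to the other without it.\<close>
    define w where "w = (u \<otimes> v) \<otimes> s"
    have w: "w \<in> carrier R - P" unfolding w_def using u l st by (intro denominator_closed(2))
    have c: "u \<in> carrier R" "v \<in> carrier R" "s \<in> carrier R" "t \<in> carrier R" "r \<in> carrier R"
      using u l st by auto
    have "(w \<otimes> t) \<odot>\<^bsub>M\<^esub> l = ((u \<otimes> t) \<otimes> (v \<otimes> s)) \<odot>\<^bsub>M\<^esub> l"
      using c by (simp add: w_def m_ac)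
    also have "\<dots> = ((v \<otimes> r) \<otimes> (u \<otimes> t)) \<odot>\<^bsub>M\<^esub> m"
      using c l mn by (simp only: smult_assoc1 R.m_closed l(4)) (simp add: smult_assoc1[symmetric] m_ac)
    also have "\<dots> = ((v \<otimes> r) \<otimes> (u \<otimes> s)) \<odot>\<^bsub>M\<^esub> n"
      using c mn eq by (simp only: smult_assoc1 R.m_closed eq)
    also have "\<dots> = (w \<otimes> r) \<odot>\<^bsub>M\<^esub> n" using c by (simp add: w_def m_ac)
    finally show "q \<in> frac n t" using l w mn st by (auto simp: mem_frac_iff)
  qed
  show ?thesis
    using sub[OF assms(1-4) u(2)] sub[OF assms(2,1,4,3) u(2)[symmetric]] by blast
qed

lemma frac_self: "m \<in> carrier M \<Longrightarrow> s \<in> carrier R - P \<Longrightarrow> (m, s) \<in> frac m s"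
  using denominator_closed(1) by (auto simp: mem_frac_iff)

lemma frac_eq_iff:
  assumes "m \<in> carrier M" "n \<in> carrier M" "s \<in> carrier R - P" "t \<in> carrier R - P"
  shows "frac m s = frac n t \<longleftrightarrow> (\<exists>u\<in>carrier R - P. (u \<otimes> t) \<odot>\<^bsub>M\<^esub> m = (u \<otimes> s) \<odot>\<^bsub>M\<^esub> n)"
  using frac_eqI[OF assms] frac_self[of m s] mem_frac_iff[of n t m s] assms by auto

lemma frac_cancel:
  assumes "m \<in> carrier M" "s \<in> carrier R - P" "t \<in> carrier R - P"
  shows "frac (t \<odot>\<^bsub>M\<^esub> m) (t \<otimes> s) = frac m s"
  using assms denominator_closed
  by (intro frac_eqI[of _ _ _ _ \<one>]) (auto simp: smult_assoc1[symmetric] m_ac)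

lemma loc_mod_carrier: "carrier (loc_mod R M P) = (\<lambda>(m, s). frac m s) ` (carrier M \<times> (carrier R - P))"
  by (auto simp: loc_mod_def)

lemma frac_closed: "m \<in> carrier M \<Longrightarrow> s \<in> carrier R - P \<Longrightarrow> frac m s \<in> carrier (loc_mod R M P)"
  by (auto simp: loc_mod_carrier)

lemma loc_modE:
  assumes "X \<in> carrier (loc_mod R M P)"
  obtains m s where "m \<in> carrier M" "s \<in> carrier R - P" "X = frac m s"
  using assms by (auto simp: loc_mod_carrier)

lemma frac_add:
  assumes "m \<in> carrier M" "n \<in> carrier M" "s \<in> carrier R - P" "t \<in> carrier R - P"
  shows "frac m s \<oplus>\<^bsub>loc_mod R M P\<^esub> frac n t = frac (t \<odot>\<^bsub>M\<^esub> m \<oplus>\<^bsub>M\<^esub> s \<odot>\<^bsub>M\<^esub> n) (s \<otimes> t)"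
proof -
  have *: "frac (t' \<odot>\<^bsub>M\<^esub> m' \<oplus>\<^bsub>M\<^esub> s' \<odot>\<^bsub>M\<^esub> n') (s' \<otimes> t') = frac (t \<odot>\<^bsub>M\<^esub> m \<oplus>\<^bsub>M\<^esub> s \<odot>\<^bsub>M\<^esub> n) (s \<otimes> t)"
    if in1: "(m', s') \<in> frac m s" and in2: "(n', t') \<in> frac n t" for m' s' n' t'
  proof -
    from in1 obtain u where 1: "m' \<in> carrier M" "s' \<in> carrier R - P" "u \<in> carrier R - P"
      "(u \<otimes> s) \<odot>\<^bsub>M\<^esub> m' = (u \<otimes> s') \<odot>\<^bsub>M\<^esub> m" using assms by (auto simp: mem_frac_iff)
    from in2 obtain v where 2: "n' \<in> carrier M" "t' \<in> carrier R - P" "v \<in> carrier R - P"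
      "(v \<otimes> t) \<odot>\<^bsub>M\<^esub> n' = (v \<otimes> t') \<odot>\<^bsub>M\<^esub> n" using assms by (auto simp: mem_frac_iff)
    note c = 1(1) 2(1) assms(1,2) 1(2,3)[THEN den_closed] 2(2,3)[THEN den_closed] assms(3,4)[THEN den_closed]
    \<comment> \<open>Each of the two witnessing equations is scaled by the factors that belong to
      the other fraction, so that the product of \<open>u\<close> and \<open>v\<close> becomes a
      witness for the sums.\<close>
    have e1: "(((u \<otimes> v) \<otimes> (s \<otimes> t)) \<otimes> t') \<odot>\<^bsub>M\<^esub> m' = (((u \<otimes> v) \<otimes> (s' \<otimes> t')) \<otimes> t) \<odot>\<^bsub>M\<^esub> m"
      by (rule smult_cancel_common[OF 1(4), of "v \<otimes> (t \<otimes> t')"]) (simp_all only: c R.m_closed m_ac)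
    have e2: "(((u \<otimes> v) \<otimes> (s \<otimes> t)) \<otimes> s') \<odot>\<^bsub>M\<^esub> n' = (((u \<otimes> v) \<otimes> (s' \<otimes> t')) \<otimes> s) \<odot>\<^bsub>M\<^esub> n"
      by (rule smult_cancel_common[OF 2(4), of "u \<otimes> (s \<otimes> s')"]) (simp_all only: c R.m_closed m_ac)
    show ?thesis
    proof (rule frac_eqI[of _ _ _ _ "u \<otimes> v"])
      show "(u \<otimes> v \<otimes> (s \<otimes> t)) \<odot>\<^bsub>M\<^esub> (t' \<odot>\<^bsub>M\<^esub> m' \<oplus>\<^bsub>M\<^esub> s' \<odot>\<^bsub>M\<^esub> n') =
        (u \<otimes> v \<otimes> (s' \<otimes> t')) \<odot>\<^bsub>M\<^esub> (t \<odot>\<^bsub>M\<^esub> m \<oplus>\<^bsub>M\<^esub> s \<odot>\<^bsub>M\<^esub> n)"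
        by (simp only: smult_r_distr smult_assoc1[symmetric] smult_closed R.m_closed c e1 e2)
    qed (use 1 2 assms denominator_closed(2) in \<open>simp_all add: c\<close>)
  qed
  have "frac m s \<noteq> {}" "frac n t \<noteq> {}"
    using frac_self[OF assms(1,3)] frac_self[OF assms(2,4)] by blast+
  from UN_UN_const[OF this *] show ?thesis by (simp add: loc_mod_def)
qed

lemma frac_smult:
  assumes "a \<in> carrier R" "s \<in> carrier R - P" "m \<in> carrier M" "t \<in> carrier R - P"
  shows "loc_class R P (a, s) \<odot>\<^bsub>loc_mod R M P\<^esub> frac m t = frac (a \<odot>\<^bsub>M\<^esub> m) (s \<otimes> t)"
proof -
  have *: "frac (a' \<odot>\<^bsub>M\<^esub> m') (s' \<otimes> t') = frac (a \<odot>\<^bsub>M\<^esub> m) (s \<otimes> t)"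
    if in1: "(a', s') \<in> loc_class R P (a, s)" and in2: "(m', t') \<in> frac m t" for a' s' m' t'
  proof -
    from in1 obtain u where 1: "a' \<in> carrier R" "s' \<in> carrier R - P" "u \<in> carrier R - P"
      "u \<otimes> (a' \<otimes> s \<ominus> a \<otimes> s') = \<zero>" by (auto simp: loc_class_def loc_rel_def)
    from in2 obtain v where 2: "m' \<in> carrier M" "t' \<in> carrier R - P" "v \<in> carrier R - P"
      "(v \<otimes> t) \<odot>\<^bsub>M\<^esub> m' = (v \<otimes> t') \<odot>\<^bsub>M\<^esub> m" using assms by (auto simp: mem_frac_iff)
    note c = 1(1) 2(1) assms(1,3) 1(2,3)[THEN den_closed] 2(2,3)[THEN den_closed] assms(2,4)[THEN den_closed]
    have "u \<otimes> (a' \<otimes> s) \<ominus> u \<otimes> (a \<otimes> s') = \<zero>"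
      using 1(4) by (simp add: c a_minus_def r_distr r_minus)
    then have a: "u \<otimes> (a' \<otimes> s) = u \<otimes> (a \<otimes> s')" by (simp add: c R.minus_eq_zero_iff)
    have "((u \<otimes> v) \<otimes> (s \<otimes> t)) \<odot>\<^bsub>M\<^esub> (a' \<odot>\<^bsub>M\<^esub> m') = ((v \<otimes> t) \<otimes> (u \<otimes> (a' \<otimes> s))) \<odot>\<^bsub>M\<^esub> m'"
      by (simp add: c smult_assoc1[symmetric] m_ac)
    also have "\<dots> = (((u \<otimes> v) \<otimes> (s' \<otimes> t')) \<otimes> a) \<odot>\<^bsub>M\<^esub> m"
      unfolding a
      by (rule smult_cancel_common[OF 2(4), of "u \<otimes> (a \<otimes> s')"]) (simp_all only: c R.m_closed m_ac)
    also have "\<dots> = ((u \<otimes> v) \<otimes> (s' \<otimes> t')) \<odot>\<^bsub>M\<^esub> (a \<odot>\<^bsub>M\<^esub> m)"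
      by (simp add: c smult_assoc1)
    finally show ?thesis
      by (intro frac_eqI[of _ _ _ _ "u \<otimes> v"]) (use 1 2 assms denominator_closed(2) in \<open>simp_all add: c\<close>)
  qed
  have "(a, s) \<in> loc_class R P (a, s)"
    using assms denominator_closed(1)
    by (auto simp: loc_class_def loc_rel_def R.minus_eq_zero_iff intro!: bexI[of _ \<one>])
  then have "loc_class R P (a, s) \<noteq> {}" "frac m t \<noteq> {}"
    using frac_self[OF assms(3,4)] by blast+
  from UN_UN_const[OF this *] show ?thesis by (simp add: loc_mod_def)
qed

text \<open>Closure under addition and scalars is what allows the inverse of a bijection between
  localized modules to be recognized as linear.\<close>

lemma loc_mod_add_closed:
  assumes "X \<in> carrier (loc_mod R M P)" "Y \<in> carrier (loc_mod R M P)"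
  shows "X \<oplus>\<^bsub>loc_mod R M P\<^esub> Y \<in> carrier (loc_mod R M P)"
proof -
  obtain m s where X: "m \<in> carrier M" "s \<in> carrier R - P" "X = frac m s"
    using assms(1) by (rule loc_modE)
  obtain n t where Y: "n \<in> carrier M" "t \<in> carrier R - P" "Y = frac n t"
    using assms(2) by (rule loc_modE)
  show ?thesis
    using X Y den_closed denominator_closed(2)[OF X(2) Y(2)] by (auto simp: frac_add intro!: frac_closed)
qed

lemma loc_mod_smult_closed:
  assumes "A \<in> carrier (loc_ring R P)" "X \<in> carrier (loc_mod R M P)"
  shows "A \<odot>\<^bsub>loc_mod R M P\<^esub> X \<in> carrier (loc_mod R M P)"
proof -
  obtain a s where A: "a \<in> carrier R" "s \<in> carrier R - P" "A = loc_class R P (a, s)"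
    using assms(1) by (rule loc_ringE)
  obtain m t where X: "m \<in> carrier M" "t \<in> carrier R - P" "X = frac m t"
    using assms(2) by (rule loc_modE)
  show ?thesis
    using A X denominator_closed(2)[OF A(2) X(2)] by (auto simp: frac_smult intro!: frac_closed)
qed

end

section \<open>Passing between maps over R and maps over its localization\<close>

lemma iso_upto_imp_mod_iso_loc_mod:
  assumes "module R M" "module R N" "primeideal P R" "iso_upto R \<one>\<^bsub>R\<^esub> M N"
  shows "mod_iso (loc_ring R P) (loc_mod R M P) (loc_mod R N P)"
proof -
  interpret M: localized_module R M P
    using assms by (simp add: localized_module_def)
  interpret N: localized_module R N P
    using assms by (simp add: localized_module_def)
  obtain \<phi> \<psi> where 1: "mod_hom R M N \<phi>" "mod_hom R N M \<psi>"
    "\<And>x. x \<in> carrier M \<Longrightarrow> \<psi> (\<phi> x) = \<one>\<^bsub>R\<^esub> \<odot>\<^bsub>M\<^esub> x"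
    "\<And>y. y \<in> carrier N \<Longrightarrow> \<phi> (\<psi> y) = \<one>\<^bsub>R\<^esub> \<odot>\<^bsub>N\<^esub> y"
    using assms(4) by (rule iso_uptoE) blast
  note h = mod_homD[OF 1(1)] and k = mod_homD[OF 1(2)]
  have inv: "\<psi> (\<phi> x) = x" if "x \<in> carrier M" for x using 1(3) that by simp
  have inv': "\<phi> (\<psi> x) = x" if "x \<in> carrier N" for x using 1(4) that by simp
  \<comment> \<open>\<open>F\<close> applies \<phi> to all numerators of a class at once, so no
    representative is chosen. The image is again a full class because \<phi> is bijective: a pair
    (n, t) of the target class comes from (\<psi> n, t).\<close>
  define F where "F = (\<lambda>X. (\<lambda>(m, s :: 'a). (\<phi> m, s)) ` X)"
  define G where "G = (\<lambda>X. (\<lambda>(m, s :: 'a). (\<psi> m, s)) ` X)"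
  have F: "F (M.frac m s) = N.frac (\<phi> m) s" if ms: "m \<in> carrier M" "s \<in> carrier R - P" for m s
  proof (intro equalityI subsetI)
    fix q assume "q \<in> F (M.frac m s)"
    then obtain n t where nt: "(n, t) \<in> M.frac m s" "q = (\<phi> n, t)" by (auto simp: F_def)
    then obtain u where u: "n \<in> carrier M" "t \<in> carrier R - P" "u \<in> carrier R - P"
      "(u \<otimes>\<^bsub>R\<^esub> s) \<odot>\<^bsub>M\<^esub> n = (u \<otimes>\<^bsub>R\<^esub> t) \<odot>\<^bsub>M\<^esub> m" using ms by (auto simp: M.mem_frac_iff)
    have "(u \<otimes>\<^bsub>R\<^esub> s) \<odot>\<^bsub>N\<^esub> \<phi> n = (u \<otimes>\<^bsub>R\<^esub> t) \<odot>\<^bsub>N\<^esub> \<phi> m"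
      using arg_cong[OF u(4), of \<phi>] u(1-3) ms by (simp add: h)
    with u ms nt show "q \<in> N.frac (\<phi> m) s" by (auto simp: N.mem_frac_iff h)
  next
    fix q assume q: "q \<in> N.frac (\<phi> m) s"
    obtain n t where nt: "q = (n, t)" by (cases q)
    with q obtain u where u: "n \<in> carrier N" "t \<in> carrier R - P" "u \<in> carrier R - P"
      "(u \<otimes>\<^bsub>R\<^esub> s) \<odot>\<^bsub>N\<^esub> n = (u \<otimes>\<^bsub>R\<^esub> t) \<odot>\<^bsub>N\<^esub> \<phi> m" using ms h by (auto simp: N.mem_frac_iff)
    have "(u \<otimes>\<^bsub>R\<^esub> s) \<odot>\<^bsub>M\<^esub> \<psi> n = (u \<otimes>\<^bsub>R\<^esub> t) \<odot>\<^bsub>M\<^esub> m"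
      using arg_cong[OF u(4), of \<psi>] u(1-3) ms by (simp add: h k inv)
    then have "(\<psi> n, t) \<in> M.frac m s" using u ms by (auto simp: M.mem_frac_iff k)
    then show "q \<in> F (M.frac m s)"
      unfolding F_def nt using u(1) by (intro image_eqI) (auto simp: inv')
  qed
  have "mod_hom (loc_ring R P) (loc_mod R M P) (loc_mod R N P) F"
  proof (rule mod_homI)
    fix X assume "X \<in> carrier (loc_mod R M P)"
    then obtain m s where X: "m \<in> carrier M" "s \<in> carrier R - P" "X = M.frac m s"
      by (rule M.loc_modE)
    then show "F X \<in> carrier (loc_mod R N P)" using N.frac_closed h F by metis
    {
      fix Y assume "Y \<in> carrier (loc_mod R M P)"
      then obtain n t where Y: "n \<in> carrier M" "t \<in> carrier R - P" "Y = M.frac n t"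
        by (rule M.loc_modE)
      show "F (X \<oplus>\<^bsub>loc_mod R M P\<^esub> Y) = F X \<oplus>\<^bsub>loc_mod R N P\<^esub> F Y"
        using X Y M.denominator_closed(2)[OF X(2) Y(2)]
        by (simp add: F M.frac_add N.frac_add h)
    }
    {
      fix A assume "A \<in> carrier (loc_ring R P)"
      then obtain a t where A: "a \<in> carrier R" "t \<in> carrier R - P" "A = loc_class R P (a, t)"
        by (rule loc_ringE)
      show "F (A \<odot>\<^bsub>loc_mod R M P\<^esub> X) = A \<odot>\<^bsub>loc_mod R N P\<^esub> F X"
        using X A M.denominator_closed(2)[OF A(2) X(2)]
        by (simp add: F M.frac_smult N.frac_smult h)
    }
  qed
  moreover have "bij_betw F (carrier (loc_mod R M P)) (carrier (loc_mod R N P))"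
    unfolding bij_betw_def
  proof
    have "G (F X) = X" if "X \<in> carrier (loc_mod R M P)" for X
    proof -
      have "X \<subseteq> carrier M \<times> UNIV"
        using that by (auto simp: M.loc_mod_carrier locm_class_def)
      then show ?thesis unfolding F_def G_def image_image
        by (force simp: inv image_iff)
    qed
    then show "inj_on F (carrier (loc_mod R M P))" by (rule inj_on_inverseI)
    have "N.frac n s \<in> F ` carrier (loc_mod R M P)" if "n \<in> carrier N" "s \<in> carrier R - P" for n s
      using F[of "\<psi> n" s] M.frac_closed[of "\<psi> n" s] that by (auto simp: inv' k)
    then show "F ` carrier (loc_mod R M P) = carrier (loc_mod R N P)"
      using F N.frac_closed h by (auto simp: M.loc_mod_carrier N.loc_mod_carrier)
  qed
  ultimately show ?thesis unfolding mod_iso_def by blast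
qed

text \<open>The dual basis: \<open>x i\<close> is the image of the i-th unit vector, and
  \<open>c i\<close> is the i-th coordinate of the section. Linearity of the \<open>c i\<close> is
  the gain over a mere generating set: arbitrary values prescribed on the \<open>x i\<close> define
  a linear map, with no relations to respect.\<close>

lemma fg_projective_dual_basis:
  fixes R :: "('a, 'r) ring_scheme" and M :: "('a, 'm) module"
  assumes "fg_projective R M"
  obtains n :: nat and x c where
    "\<And>i. x i \<in> carrier M"
    "\<And>i m. i < n \<Longrightarrow> m \<in> carrier M \<Longrightarrow> c i m \<in> carrier R"
    "\<And>i m m'. i < n \<Longrightarrow> m \<in> carrier M \<Longrightarrow> m' \<in> carrier M \<Longrightarrow> c i (m \<oplus>\<^bsub>M\<^esub> m') = c i m \<oplus>\<^bsub>R\<^esub> c i m'"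
    "\<And>i a m. i < n \<Longrightarrow> a \<in> carrier R \<Longrightarrow> m \<in> carrier M \<Longrightarrow> c i (a \<odot>\<^bsub>M\<^esub> m) = a \<otimes>\<^bsub>R\<^esub> c i m"
    "\<And>m. m \<in> carrier M \<Longrightarrow> finsum M (\<lambda>i. c i m \<odot>\<^bsub>M\<^esub> x i) {..<n} = m"
proof -
  interpret M: module R M using assms by (simp add: fg_projective_def)
  have R: "cring R" by (rule M.R.cring_axioms)
  obtain n p s where ps: "mod_hom R (free_mod R n) M p" "mod_hom R M (free_mod R n) s"
    "\<And>x. x \<in> carrier M \<Longrightarrow> p (s x) = x"
    using assms unfolding fg_projective_def by blast
  interpret F: module R "free_mod R n" by (rule free_mod_module[OF R])
  note u = unit_vec_closed[OF R, of n]
  show ?thesis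
  proof (rule that[of "\<lambda>i. p (unit_vec R n i)" n "\<lambda>i m. s m i"])
    \<comment> \<open>No bound on \<open>i\<close> is required, because
      \<open>unit_vec R n i\<close> is the zero vector for \<open>i\<close> at least
      \<open>n\<close>.\<close>
    show "p (unit_vec R n i) \<in> carrier M" for i by (rule mod_homD(1)[OF ps(1) u])
    show c: "s m i \<in> carrier R" if "i < n" "m \<in> carrier M" for i m
      using mod_homD(1)[OF ps(2) that(2)] that(1) by (auto simp: PiE_iff)
    show "s (m \<oplus>\<^bsub>M\<^esub> m') i = s m i \<oplus>\<^bsub>R\<^esub> s m' i" if "i < n" "m \<in> carrier M" "m' \<in> carrier M" for i m m'
      using that by (simp add: mod_homD[OF ps(2)])
    show "s (a \<odot>\<^bsub>M\<^esub> m) i = a \<otimes>\<^bsub>R\<^esub> s m i" if "i < n" "a \<in> carrier R" "m \<in> carrier M" for i a m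
      using that by (simp add: mod_homD[OF ps(2)])
    show "finsum M (\<lambda>i. s m i \<odot>\<^bsub>M\<^esub> p (unit_vec R n i)) {..<n} = m" if m: "m \<in> carrier M" for m
    proof -
      have "m = p (finsum (free_mod R n) (\<lambda>i. s m i \<odot>\<^bsub>free_mod R n\<^esub> unit_vec R n i) {..<n})"
        by (simp only: free_mod_expand[OF R mod_homD(1)[OF ps(2) m]] ps(3)[OF m])
      also have "\<dots> = finsum M (\<lambda>i. p (s m i \<odot>\<^bsub>free_mod R n\<^esub> unit_vec R n i)) {..<n}"
        using c[OF _ m] u F.smult_closed
        by (intro mod_hom_finsum[OF F.module_axioms M.module_axioms ps(1)]) blast+
      also have "\<dots> = finsum M (\<lambda>i. s m i \<odot>\<^bsub>M\<^esub> p (unit_vec R n i)) {..<n}"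
      proof (rule M.M.finsum_cong')
        show "p (s m i \<odot>\<^bsub>free_mod R n\<^esub> unit_vec R n i) = s m i \<odot>\<^bsub>M\<^esub> p (unit_vec R n i)"
          if "i \<in> {..<n}" for i
          using c[OF _ m] that by (intro mod_homD(3)[OF ps(1) _ u]) simp
        show "(\<lambda>i. s m i \<odot>\<^bsub>M\<^esub> p (unit_vec R n i)) \<in> {..<n} \<rightarrow> carrier M"
          using c[OF _ m] mod_homD(1)[OF ps(1) u] by auto
      qed simp
      finally show ?thesis by simp
    qed
  qed
qed

text \<open>A witness \<open>u\<close> may vary with \<open>m\<close>, but one can be chosen for the
  finitely many \<open>x i\<close> together. After multiplication by it, \<open>f\<close> and
  \<open>g\<close> agree on these generators, hence everywhere.\<close>

lemma uniform_denominator: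
  assumes "fg_projective R M" "module R N" "primeideal P R"
    and "mod_hom R M N f" "mod_hom R M N g"
    and "\<And>m. m \<in> carrier M \<Longrightarrow> \<exists>u\<in>carrier R - P. u \<odot>\<^bsub>N\<^esub> f m = u \<odot>\<^bsub>N\<^esub> g m"
  shows "\<exists>u\<in>carrier R - P. \<forall>m\<in>carrier M. u \<odot>\<^bsub>N\<^esub> f m = u \<odot>\<^bsub>N\<^esub> g m"
proof -
  interpret P: primeideal P R by fact
  interpret M: module R M using assms by (simp add: fg_projective_def)
  interpret N: module R N by fact
  obtain n :: nat and x c where b:
    "\<And>i. x i \<in> carrier M"
    "\<And>i m. i < n \<Longrightarrow> m \<in> carrier M \<Longrightarrow> c i m \<in> carrier R"
    "\<And>m. m \<in> carrier M \<Longrightarrow> finsum M (\<lambda>i. c i m \<odot>\<^bsub>M\<^esub> x i) {..<n} = m"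
    by (rule fg_projective_dual_basis[OF assms(1)]) (rule that)
  have "\<exists>u\<in>carrier R - P. \<forall>i\<in>{..<n}. u \<odot>\<^bsub>N\<^esub> f (x i) = u \<odot>\<^bsub>N\<^esub> g (x i)"
    using assms(6) b(1) mod_homD(1)[OF assms(4)] mod_homD(1)[OF assms(5)]
    by (intro P.common_denominator) (simp_all add: N.smult_assoc1)
  then obtain u where u: "u \<in> carrier R - P" "\<And>i. i < n \<Longrightarrow> u \<odot>\<^bsub>N\<^esub> f (x i) = u \<odot>\<^bsub>N\<^esub> g (x i)"
    by auto
  have expand: "u \<odot>\<^bsub>N\<^esub> h m = finsum N (\<lambda>i. c i m \<odot>\<^bsub>N\<^esub> (u \<odot>\<^bsub>N\<^esub> h (x i))) {..<n}"
    if h: "mod_hom R M N h" and m: "m \<in> carrier M" for h m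
  proof -
    have uh: "mod_hom R M N (\<lambda>x. u \<odot>\<^bsub>N\<^esub> h x)" using mod_hom_smult[OF assms(2) h] u by simp
    have "u \<odot>\<^bsub>N\<^esub> h m = u \<odot>\<^bsub>N\<^esub> h (finsum M (\<lambda>i. c i m \<odot>\<^bsub>M\<^esub> x i) {..<n})"
      by (simp only: b(3)[OF m])
    also have "\<dots> = finsum N (\<lambda>i. u \<odot>\<^bsub>N\<^esub> h (c i m \<odot>\<^bsub>M\<^esub> x i)) {..<n}"
      using b m by (intro mod_hom_finsum[OF M.module_axioms N.module_axioms uh]) auto
    also have "\<dots> = finsum N (\<lambda>i. c i m \<odot>\<^bsub>N\<^esub> (u \<odot>\<^bsub>N\<^esub> h (x i))) {..<n}"
      using b m u mod_homD(1)[OF h] by (intro N.M.finsum_cong') (auto intro!: mod_homD(3)[OF uh])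
    finally show ?thesis .
  qed
  have "u \<odot>\<^bsub>N\<^esub> f m = u \<odot>\<^bsub>N\<^esub> g m" if m: "m \<in> carrier M" for m
    unfolding expand[OF assms(4) m] expand[OF assms(5) m]
    using b(1,2) u m mod_homD(1)[OF assms(5)] by (intro N.M.finsum_cong') auto
  with u(1) show ?thesis by blast
qed

text \<open>Clearing denominators from a local homomorphism. The finitely many values
  \<open>F\<close> (x_i/1) are written y_i/s over one denominator, and \<open>f\<close> is the
  linear map built from the \<open>y i\<close> and the dual basis; it represents \<open>s\<close>
  times \<open>F\<close>.\<close>

lemma loc_mod_hom_lift:
  fixes R :: "('a, 'r) ring_scheme" and M :: "('a, 'm) module" and N :: "('a, 'n) module"
  assumes "fg_projective R M" "module R N" "primeideal P R"
    and F: "mod_hom (loc_ring R P) (loc_mod R M P) (loc_mod R N P) F"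
  obtains f s where "mod_hom R M N f" "s \<in> carrier R - P"
    "\<And>m. m \<in> carrier M \<Longrightarrow> F (locm_class R M P (m, \<one>\<^bsub>R\<^esub>)) = locm_class R N P (f m, s)"
proof -
  interpret M: localized_module R M P
    using assms by (simp add: localized_module_def fg_projective_def)
  interpret N: localized_module R N P
    using assms by (simp add: localized_module_def)
  obtain n :: nat and x c where b:
    "\<And>i. x i \<in> carrier M"
    "\<And>i m. i < n \<Longrightarrow> m \<in> carrier M \<Longrightarrow> c i m \<in> carrier R"
    "\<And>i m m'. i < n \<Longrightarrow> m \<in> carrier M \<Longrightarrow> m' \<in> carrier M \<Longrightarrow> c i (m \<oplus>\<^bsub>M\<^esub> m') = c i m \<oplus>\<^bsub>R\<^esub> c i m'"
    "\<And>i a m. i < n \<Longrightarrow> a \<in> carrier R \<Longrightarrow> m \<in> carrier M \<Longrightarrow> c i (a \<odot>\<^bsub>M\<^esub> m) = a \<otimes>\<^bsub>R\<^esub> c i m"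
    "\<And>m. m \<in> carrier M \<Longrightarrow> finsum M (\<lambda>i. c i m \<odot>\<^bsub>M\<^esub> x i) {..<n} = m"
    by (rule fg_projective_dual_basis[OF assms(1)]) (rule that)
  note one = M.denominator_closed(1)
  have "\<exists>s\<in>carrier R - P. \<forall>i\<in>{..<n}. \<exists>y\<in>carrier N. F (M.frac (x i) \<one>\<^bsub>R\<^esub>) = N.frac y s"
  proof (rule M.common_denominator)
    show "\<exists>s\<in>carrier R - P. \<exists>y\<in>carrier N. F (M.frac (x i) \<one>\<^bsub>R\<^esub>) = N.frac y s" for i
      using mod_homD(1)[OF F M.frac_closed[OF b(1) one]] by (rule N.loc_modE) blast
    show "\<exists>y\<in>carrier N. F (M.frac (x i) \<one>\<^bsub>R\<^esub>) = N.frac y (t \<otimes>\<^bsub>R\<^esub> s)"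
      if "s \<in> carrier R - P" "t \<in> carrier R - P"
        "\<exists>y\<in>carrier N. F (M.frac (x i) \<one>\<^bsub>R\<^esub>) = N.frac y s" for i s t
      using that N.frac_cancel[OF _ that(1,2)] N.smult_closed[OF M.den_closed[OF that(2)]] by metis
  qed simp
  then obtain s y where s: "s \<in> carrier R - P"
    and y: "\<And>i. i < n \<Longrightarrow> y i \<in> carrier N" "\<And>i. i < n \<Longrightarrow> F (M.frac (x i) \<one>\<^bsub>R\<^esub>) = N.frac (y i) s"
    by (metis lessThan_iff)
  have sR: "s \<in> carrier R" using s by simp
  define f where "f = (\<lambda>m. finsum N (\<lambda>i. c i m \<odot>\<^bsub>N\<^esub> y i) {..<n})"
  have hom: "mod_hom R M N f"
  proof (rule mod_homI)
    fix m assume m: "m \<in> carrier M"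
    show "f m \<in> carrier N" unfolding f_def using b m y by (intro N.finsum_closed) auto
    show "f (m \<oplus>\<^bsub>M\<^esub> m') = f m \<oplus>\<^bsub>N\<^esub> f m'" if m': "m' \<in> carrier M" for m'
    proof -
      have "f (m \<oplus>\<^bsub>M\<^esub> m') = finsum N (\<lambda>i. c i m \<odot>\<^bsub>N\<^esub> y i \<oplus>\<^bsub>N\<^esub> c i m' \<odot>\<^bsub>N\<^esub> y i) {..<n}"
        unfolding f_def using b m m' y by (intro N.finsum_cong') (auto simp: N.smult_l_distr)
      also have "\<dots> = f m \<oplus>\<^bsub>N\<^esub> f m'"
        unfolding f_def using b m m' y by (intro N.finsum_addf) auto
      finally show ?thesis .
    qed
    show "f (a \<odot>\<^bsub>M\<^esub> m) = a \<odot>\<^bsub>N\<^esub> f m" if a: "a \<in> carrier R" for a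
    proof -
      have "f (a \<odot>\<^bsub>M\<^esub> m) = finsum N (\<lambda>i. a \<odot>\<^bsub>N\<^esub> (c i m \<odot>\<^bsub>N\<^esub> y i)) {..<n}"
        unfolding f_def using b m a y by (intro N.finsum_cong') (auto simp: N.smult_assoc1)
      also have "\<dots> = a \<odot>\<^bsub>N\<^esub> f m"
        unfolding f_def using b m a y by (intro N.finsum_smult_ldistr[symmetric]) auto
      finally show ?thesis .
    qed
  qed
  \<comment> \<open>Done by induction on the index set with the rules for fractions;
    \<open>mod_hom_finsum\<close> would call for the module axioms of M_P and N_P.\<close>
  have sums: "F (M.frac (finsum M (\<lambda>i. a i \<odot>\<^bsub>M\<^esub> x i) A) \<one>\<^bsub>R\<^esub>) = N.frac (finsum N (\<lambda>i. a i \<odot>\<^bsub>N\<^esub> y i) A) s"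
    if "finite A" "A \<subseteq> {..<n}" "\<And>i. i \<in> A \<Longrightarrow> a i \<in> carrier R" for A a
    using that
  proof (induction A rule: finite_induct)
    case empty
    let ?X = "M.frac \<zero>\<^bsub>M\<^esub> \<one>\<^bsub>R\<^esub>"
    obtain z t where z: "z \<in> carrier N" "t \<in> carrier R - P" "F ?X = N.frac z t"
      using mod_homD(1)[OF F M.frac_closed[OF M.M.zero_closed one]] by (rule N.loc_modE)
    \<comment> \<open>Writing 0/1 as the zero scalar times itself shows that its image has numerator
      0, over whatever denominator \<open>t\<close>; all fractions with numerator 0 agree.\<close>
    have "?X = loc_class R P (\<zero>\<^bsub>R\<^esub>, \<one>\<^bsub>R\<^esub>) \<odot>\<^bsub>loc_mod R M P\<^esub> ?X"
      using one by (simp add: M.frac_smult)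
    then have "F ?X = loc_class R P (\<zero>\<^bsub>R\<^esub>, \<one>\<^bsub>R\<^esub>) \<odot>\<^bsub>loc_mod R N P\<^esub> F ?X"
      using mod_homD(3)[OF F loc_class_closed[OF M.R.zero_closed one] M.frac_closed[OF M.M.zero_closed one]]
      by simp
    also have "\<dots> = N.frac \<zero>\<^bsub>N\<^esub> t"
      using one z by (simp add: N.frac_smult)
    also have "\<dots> = N.frac \<zero>\<^bsub>N\<^esub> s"
      using s z one by (intro N.frac_eqI[of _ _ _ _ "\<one>\<^bsub>R\<^esub>"]) auto
    finally show ?case by simp
  next
    case (insert i A)
    let ?x = "finsum M (\<lambda>i. a i \<odot>\<^bsub>M\<^esub> x i) A" and ?y = "finsum N (\<lambda>i. a i \<odot>\<^bsub>N\<^esub> y i) A"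
    let ?a = "loc_class R P (a i, \<one>\<^bsub>R\<^esub>)"
    have i: "i < n" "a i \<in> carrier R" "A \<subseteq> {..<n}" using insert.prems by auto
    have yA: "y j \<in> carrier N" if "j \<in> A" for j using y that i by auto
    have x: "?x \<in> carrier M" using insert.prems b by (intro M.M.finsum_closed) auto
    have y': "?y \<in> carrier N" using insert.prems yA by (intro N.M.finsum_closed) auto
    have fx: "finsum M (\<lambda>i. a i \<odot>\<^bsub>M\<^esub> x i) (insert i A) = a i \<odot>\<^bsub>M\<^esub> x i \<oplus>\<^bsub>M\<^esub> ?x"
      using insert b by (intro M.M.finsum_insert) auto
    have fy: "finsum N (\<lambda>i. a i \<odot>\<^bsub>N\<^esub> y i) (insert i A) = a i \<odot>\<^bsub>N\<^esub> y i \<oplus>\<^bsub>N\<^esub> ?y"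
      using insert y(1)[OF i(1)] yA by (intro N.M.finsum_insert) auto
    note A = loc_class_closed[where P = P, OF i(2) one] and X = M.frac_closed[OF b(1)[of i] one]
      and Y = M.frac_closed[OF x one]
    note AX = M.loc_mod_smult_closed[OF A X]
    have IH: "F (M.frac ?x \<one>\<^bsub>R\<^esub>) = N.frac ?y s"
      using insert.prems by (intro insert.IH) auto
    have "M.frac (a i \<odot>\<^bsub>M\<^esub> x i \<oplus>\<^bsub>M\<^esub> ?x) \<one>\<^bsub>R\<^esub> =
        ?a \<odot>\<^bsub>loc_mod R M P\<^esub> M.frac (x i) \<one>\<^bsub>R\<^esub> \<oplus>\<^bsub>loc_mod R M P\<^esub> M.frac ?x \<one>\<^bsub>R\<^esub>"
      using one i x b by (simp add: M.frac_smult M.frac_add)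
    also have "F \<dots> = ?a \<odot>\<^bsub>loc_mod R N P\<^esub> N.frac (y i) s \<oplus>\<^bsub>loc_mod R N P\<^esub> N.frac ?y s"
      by (simp only: mod_homD(2)[OF F AX Y] mod_homD(3)[OF F A X] y(2)[OF i(1)] IH)
    \<comment> \<open>Adding two fractions over \<open>s\<close> produces the denominator
      \<open>s\<close> squared and an extra factor \<open>s\<close> in the numerator, which then
      cancel.\<close>
    also have "\<dots> = N.frac (s \<odot>\<^bsub>N\<^esub> (a i \<odot>\<^bsub>N\<^esub> y i \<oplus>\<^bsub>N\<^esub> ?y)) (s \<otimes>\<^bsub>R\<^esub> s)"
      using one s sR i y(1)[OF i(1)] y' by (simp add: N.frac_smult N.frac_add N.smult_r_distr)
    also have "\<dots> = N.frac (a i \<odot>\<^bsub>N\<^esub> y i \<oplus>\<^bsub>N\<^esub> ?y) s"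
      using s sR i y(1)[OF i(1)] y' by (intro N.frac_cancel) auto
    finally show ?case unfolding fx fy .
  qed
  have "F (M.frac m \<one>\<^bsub>R\<^esub>) = N.frac (f m) s" if "m \<in> carrier M" for m
    using sums[of "{..<n}" "\<lambda>i. c i m"] b(2)[OF _ that] b(5)[OF that] by (simp add: f_def)
  then show ?thesis by (rule that[OF hom s])
qed

text \<open>Since \<open>F\<close> (m/1) is (f m)/s, scaling by \<open>s\<close> and applying
  \<open>G\<close> gives (s m)/1 = (g (f m))/t. Equality of these fractions is the claim for a
  single \<open>m\<close>, and \<open>uniform_denominator\<close> makes the witness independent of
  \<open>m\<close>.\<close>

lemma loc_mod_lift_inverse:
  assumes "fg_projective R M" "module R N" "primeideal P R"
    and F: "mod_hom (loc_ring R P) (loc_mod R M P) (loc_mod R N P) F"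
    and G: "mod_hom (loc_ring R P) (loc_mod R N P) (loc_mod R M P) G"
    and GF: "\<And>X. X \<in> carrier (loc_mod R M P) \<Longrightarrow> G (F X) = X"
    and f: "mod_hom R M N f" "s \<in> carrier R - P"
      "\<And>m. m \<in> carrier M \<Longrightarrow> F (locm_class R M P (m, \<one>\<^bsub>R\<^esub>)) = locm_class R N P (f m, s)"
    and g: "mod_hom R N M g" "t \<in> carrier R - P"
      "\<And>n. n \<in> carrier N \<Longrightarrow> G (locm_class R N P (n, \<one>\<^bsub>R\<^esub>)) = locm_class R M P (g n, t)"
  shows "\<exists>u\<in>carrier R - P. \<forall>m\<in>carrier M. u \<odot>\<^bsub>M\<^esub> g (f m) = u \<odot>\<^bsub>M\<^esub> ((t \<otimes>\<^bsub>R\<^esub> s) \<odot>\<^bsub>M\<^esub> m)"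
proof -
  have M: "module R M" using assms(1) by (simp add: fg_projective_def)
  interpret M: localized_module R M P
    using assms by (simp add: localized_module_def fg_projective_def)
  interpret N: localized_module R N P
    using assms by (simp add: localized_module_def)
  note one = M.denominator_closed(1)
  have st: "s \<in> carrier R" "t \<in> carrier R" using f g by auto
  have "\<exists>u\<in>carrier R - P. u \<odot>\<^bsub>M\<^esub> g (f m) = u \<odot>\<^bsub>M\<^esub> ((t \<otimes>\<^bsub>R\<^esub> s) \<odot>\<^bsub>M\<^esub> m)" if m: "m \<in> carrier M" for m
  proof -
    let ?s = "loc_class R P (s, \<one>\<^bsub>R\<^esub>)"
    note fm = mod_homD(1)[OF f(1) m]
    note gfm = mod_homD(1)[OF g(1) fm]
    note X = M.frac_closed[OF m one]
    have "M.frac (s \<odot>\<^bsub>M\<^esub> m) \<one>\<^bsub>R\<^esub> = ?s \<odot>\<^bsub>loc_mod R M P\<^esub> G (F (M.frac m \<one>\<^bsub>R\<^esub>))"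
      using GF[OF X] m st one by (simp add: M.frac_smult)
    also have "\<dots> = G (?s \<odot>\<^bsub>loc_mod R N P\<^esub> F (M.frac m \<one>\<^bsub>R\<^esub>))"
      using mod_homD(3)[OF G loc_class_closed[OF st(1) one] mod_homD(1)[OF F X]] by simp
    also have "?s \<odot>\<^bsub>loc_mod R N P\<^esub> F (M.frac m \<one>\<^bsub>R\<^esub>) = N.frac (s \<odot>\<^bsub>N\<^esub> f m) (\<one>\<^bsub>R\<^esub> \<otimes>\<^bsub>R\<^esub> s)"
      unfolding f(3)[OF m] by (rule N.frac_smult[OF st(1) one fm f(2)])
    also have "\<dots> = N.frac (s \<odot>\<^bsub>N\<^esub> f m) (s \<otimes>\<^bsub>R\<^esub> \<one>\<^bsub>R\<^esub>)" using st by simp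
    also have "\<dots> = N.frac (f m) \<one>\<^bsub>R\<^esub>" by (rule N.frac_cancel[OF fm one f(2)])
    also have "G \<dots> = M.frac (g (f m)) t" by (rule g(3)[OF fm])
    finally obtain u where u: "u \<in> carrier R - P"
      "(u \<otimes>\<^bsub>R\<^esub> t) \<odot>\<^bsub>M\<^esub> (s \<odot>\<^bsub>M\<^esub> m) = (u \<otimes>\<^bsub>R\<^esub> \<one>\<^bsub>R\<^esub>) \<odot>\<^bsub>M\<^esub> g (f m)"
      using M.frac_eq_iff[OF M.smult_closed[OF st(1) m] gfm one g(2)] by blast
    then have "u \<odot>\<^bsub>M\<^esub> g (f m) = u \<odot>\<^bsub>M\<^esub> ((t \<otimes>\<^bsub>R\<^esub> s) \<odot>\<^bsub>M\<^esub> m)"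
      using st m by (simp add: M.smult_assoc1)
    with u(1) show ?thesis by blast
  qed
  moreover have "mod_hom R M M (\<lambda>m. (t \<otimes>\<^bsub>R\<^esub> s) \<odot>\<^bsub>M\<^esub> m)"
    using mod_hom_smult[OF M, of M "\<lambda>x. x"] st by (simp add: mod_homI)
  ultimately show ?thesis
    using uniform_denominator[OF assms(1) M assms(3) mod_hom_comp[OF f(1) g(1)]] by blast
qed

text \<open>A local isomorphism and its inverse are lifted separately, so the lifts are inverse only
  up to the denominators \<open>s\<close>, \<open>t\<close> and up to torsion witnesses
  \<open>u\<close>, \<open>v\<close>, one for each composite. Putting both \<open>u\<close> and
  \<open>v\<close> into one of the two maps makes the composites the same scalar.\<close>

lemma mod_iso_loc_mod_imp_iso_upto:
  assumes "fg_projective R M" "fg_projective R N" "primeideal P R"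
    and "mod_iso (loc_ring R P) (loc_mod R M P) (loc_mod R N P)"
  obtains s where "s \<in> carrier R - P" "iso_upto R s M N"
proof -
  have MN: "module R M" "module R N" using assms(1,2) by (auto simp: fg_projective_def)
  interpret M: localized_module R M P
    using assms MN by (simp add: localized_module_def)
  interpret N: localized_module R N P
    using assms MN by (simp add: localized_module_def)
  obtain F where F: "mod_hom (loc_ring R P) (loc_mod R M P) (loc_mod R N P) F"
    "bij_betw F (carrier (loc_mod R M P)) (carrier (loc_mod R N P))"
    using assms(4) unfolding mod_iso_def by blast
  define G where "G = inv_into (carrier (loc_mod R M P)) F"
  have GF: "G (F X) = X" if "X \<in> carrier (loc_mod R M P)" for X
    using that F(2) by (auto simp: bij_betw_def G_def)
  have FG: "G X \<in> carrier (loc_mod R M P)" "F (G X) = X" if "X \<in> carrier (loc_mod R N P)" for X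
    using that F(2) by (auto simp: bij_betw_def G_def inv_into_into f_inv_into_f)
  \<comment> \<open>Linearity of the inverse: \<open>G\<close> undoes \<open>F\<close> on the
    candidate value, which closure of M_P places in the domain of \<open>F\<close>.\<close>
  have G: "mod_hom (loc_ring R P) (loc_mod R N P) (loc_mod R M P) G"
  proof (rule mod_homI)
    fix X assume X: "X \<in> carrier (loc_mod R N P)"
    show "G X \<in> carrier (loc_mod R M P)" by (rule FG(1)[OF X])
    {
      fix Y assume Y: "Y \<in> carrier (loc_mod R N P)"
      have "G X \<oplus>\<^bsub>loc_mod R M P\<^esub> G Y \<in> carrier (loc_mod R M P)"
        using FG(1)[OF X] FG(1)[OF Y] by (rule M.loc_mod_add_closed)
      from GF[OF this] show "G (X \<oplus>\<^bsub>loc_mod R N P\<^esub> Y) = G X \<oplus>\<^bsub>loc_mod R M P\<^esub> G Y"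
        using X Y by (simp add: mod_homD(2)[OF F(1)] FG)
    }
    {
      fix A assume A: "A \<in> carrier (loc_ring R P)"
      have "A \<odot>\<^bsub>loc_mod R M P\<^esub> G X \<in> carrier (loc_mod R M P)"
        using A FG(1)[OF X] by (rule M.loc_mod_smult_closed)
      from GF[OF this] show "G (A \<odot>\<^bsub>loc_mod R N P\<^esub> X) = A \<odot>\<^bsub>loc_mod R M P\<^esub> G X"
        using X A by (simp add: mod_homD(3)[OF F(1)] FG)
    }
  qed
  obtain f s where f: "mod_hom R M N f" "s \<in> carrier R - P"
    "\<And>m. m \<in> carrier M \<Longrightarrow> F (M.frac m \<one>\<^bsub>R\<^esub>) = N.frac (f m) s"
    using loc_mod_hom_lift[OF assms(1) MN(2) assms(3) F(1)] by metis
  obtain g t where g: "mod_hom R N M g" "t \<in> carrier R - P"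
    "\<And>n. n \<in> carrier N \<Longrightarrow> G (N.frac n \<one>\<^bsub>R\<^esub>) = M.frac (g n) t"
    using loc_mod_hom_lift[OF assms(2) MN(1) assms(3) G] by metis
  obtain u where u: "u \<in> carrier R - P"
    "\<And>m. m \<in> carrier M \<Longrightarrow> u \<odot>\<^bsub>M\<^esub> g (f m) = u \<odot>\<^bsub>M\<^esub> ((t \<otimes>\<^bsub>R\<^esub> s) \<odot>\<^bsub>M\<^esub> m)"
    using loc_mod_lift_inverse[OF assms(1) MN(2) assms(3) F(1) G GF f g] by blast
  obtain v where v: "v \<in> carrier R - P"
    "\<And>n. n \<in> carrier N \<Longrightarrow> v \<odot>\<^bsub>N\<^esub> f (g n) = v \<odot>\<^bsub>N\<^esub> ((s \<otimes>\<^bsub>R\<^esub> t) \<odot>\<^bsub>N\<^esub> n)"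
    using loc_mod_lift_inverse[OF assms(2) MN(1) assms(3) G F(1) FG(2) g f] by blast
  have c: "u \<in> carrier R" "v \<in> carrier R" "s \<in> carrier R" "t \<in> carrier R"
    using u v f g by auto
  note hf = mod_homD[OF f(1)] and hg = mod_homD[OF g(1)]
  have "iso_upto R ((u \<otimes>\<^bsub>R\<^esub> v) \<otimes>\<^bsub>R\<^esub> (s \<otimes>\<^bsub>R\<^esub> t)) M N"
  proof (rule iso_uptoI[OF _ f(1) mod_hom_smult[OF MN(1) g(1)]])
    show "(u \<otimes>\<^bsub>R\<^esub> v) \<odot>\<^bsub>M\<^esub> g (f m) = ((u \<otimes>\<^bsub>R\<^esub> v) \<otimes>\<^bsub>R\<^esub> (s \<otimes>\<^bsub>R\<^esub> t)) \<odot>\<^bsub>M\<^esub> m" if m: "m \<in> carrier M" for m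
    proof -
      have "(u \<otimes>\<^bsub>R\<^esub> v) \<odot>\<^bsub>M\<^esub> g (f m) = v \<odot>\<^bsub>M\<^esub> (u \<odot>\<^bsub>M\<^esub> g (f m))"
        using c m by (simp add: hf hg M.smult_assoc1[symmetric] M.m_comm)
      also have "\<dots> = ((u \<otimes>\<^bsub>R\<^esub> v) \<otimes>\<^bsub>R\<^esub> (s \<otimes>\<^bsub>R\<^esub> t)) \<odot>\<^bsub>M\<^esub> m"
        using c m by (simp add: u(2) M.smult_assoc1[symmetric] M.m_ac)
      finally show ?thesis .
    qed
    show "f ((u \<otimes>\<^bsub>R\<^esub> v) \<odot>\<^bsub>M\<^esub> g n) = ((u \<otimes>\<^bsub>R\<^esub> v) \<otimes>\<^bsub>R\<^esub> (s \<otimes>\<^bsub>R\<^esub> t)) \<odot>\<^bsub>N\<^esub> n" if n: "n \<in> carrier N" for n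
    proof -
      have "f ((u \<otimes>\<^bsub>R\<^esub> v) \<odot>\<^bsub>M\<^esub> g n) = u \<odot>\<^bsub>N\<^esub> (v \<odot>\<^bsub>N\<^esub> f (g n))"
        using c n by (simp add: hf hg N.smult_assoc1)
      also have "\<dots> = ((u \<otimes>\<^bsub>R\<^esub> v) \<otimes>\<^bsub>R\<^esub> (s \<otimes>\<^bsub>R\<^esub> t)) \<odot>\<^bsub>N\<^esub> n"
        using c n by (simp add: v(2) N.smult_assoc1[symmetric] M.m_assoc)
      finally show ?thesis .
    qed
  qed (use c in simp_all)
  moreover have "(u \<otimes>\<^bsub>R\<^esub> v) \<otimes>\<^bsub>R\<^esub> (s \<otimes>\<^bsub>R\<^esub> t) \<in> carrier R - P"
    using u(1) v(1) f(2) g(2) by (intro M.denominator_closed(2))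
  ultimately show ?thesis using that by blast
qed

section \<open>Gluing along idempotents\<close>

text \<open>Zorn's lemma on the ideals that contain \<open>J\<close> and omit 1. For an ideal,
  omitting 1 means being proper, and in this form the condition passes to unions of chains.\<close>

lemma (in cring) exists_maximal_ideal:
  assumes "ideal J R" "\<one> \<notin> J"
  shows "\<exists>P. maximalideal P R \<and> J \<subseteq> P"
proof -
  define S where "S = {I. ideal I R \<and> J \<subseteq> I \<and> \<one> \<notin> I}"
  have "\<exists>P\<in>S. \<forall>X\<in>S. P \<subseteq> X \<longrightarrow> X = P"
  proof (rule subset_Zorn)
    fix C assume C: "subset.chain S C"
    show "\<exists>U\<in>S. \<forall>X\<in>C. X \<subseteq> U"
    proof (cases "C = {}")
      case True
      then show ?thesis using assms by (auto simp: S_def)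
    next
      case False
      have idl: "ideal I R" if "I \<in> C" for I using that C by (auto simp: pred_on.chain_def S_def)
      note sub = idl[THEN ideal.axioms(1)]
      \<comment> \<open>Two members of a chain are comparable, so two elements of the union lie in
        one ideal; closure of the union under addition rests on this.\<close>
      have pair: "\<exists>I\<in>C. a \<in> I \<and> b \<in> I" if "a \<in> \<Union>C" "b \<in> \<Union>C" for a b
        using that C unfolding pred_on.chain_def by blast
      have "ideal (\<Union>C) R"
      proof (rule idealI[OF ring_axioms])
        show "subgroup (\<Union>C) (add_monoid R)"
        proof (rule add.subgroupI)
          show "\<Union>C \<subseteq> carrier R" using additive_subgroup.a_subset[OF sub] by blast
          show "\<Union>C \<noteq> {}" using False additive_subgroup.zero_closed[OF sub] by blast
          show "\<ominus> a \<in> \<Union>C" if "a \<in> \<Union>C" for a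
            using that additive_subgroup.a_inv_closed[OF sub] by blast
          show "a \<oplus> b \<in> \<Union>C" if "a \<in> \<Union>C" "b \<in> \<Union>C" for a b
            using pair[OF that] additive_subgroup.a_closed[OF sub] by blast
        qed
        show "x \<otimes> a \<in> \<Union>C" "a \<otimes> x \<in> \<Union>C" if "a \<in> \<Union>C" "x \<in> carrier R" for a x
          using that ideal.I_l_closed[OF idl] ideal.I_r_closed[OF idl] by blast+
      qed
      moreover obtain I where "I \<in> C" using False by blast
      then have "J \<subseteq> \<Union>C" "\<one> \<notin> \<Union>C"
        using C unfolding pred_on.chain_def S_def by blast+
      ultimately show ?thesis by (intro bexI[of _ "\<Union>C"]) (auto simp: S_def)
    qed
  qed
  then obtain P where P: "P \<in> S" and max: "\<And>X. X \<in> S \<Longrightarrow> P \<subseteq> X \<Longrightarrow> X = P" by blast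
  have "maximalideal P R"
  proof (rule maximalidealI)
    show "carrier R \<noteq> P" using P by (auto simp: S_def)
    show "X = P \<or> X = carrier R" if "ideal X R" "P \<subseteq> X" "X \<subseteq> carrier R" for X
      using that P max[of X] ideal.one_imp_carrier[OF that(1)] by (auto simp: S_def)
  qed (use P in \<open>simp add: S_def\<close>)
  with P show ?thesis by (auto simp: S_def)
qed

text \<open>\<open>k\<close> is the part of \<open>h\<close> disjoint from \<open>g\<close>, and
  \<open>g\<close> plus \<open>k\<close> is g + h - gh, the join in the Boolean algebra of
  idempotents. Presenting the join as an orthogonal sum is what makes it accessible to
  \<open>iso_upto_add_orthogonal\<close>.\<close>

lemma (in cring) idempotent_join:
  assumes "g \<in> carrier R" "g \<otimes> g = g" "h \<in> carrier R" "h \<otimes> h = h"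
  defines "k \<equiv> (\<one> \<ominus> g) \<otimes> h"
  shows "k \<in> carrier R" "k \<otimes> k = k" "g \<otimes> k = \<zero>" "(g \<oplus> k) \<otimes> (g \<oplus> k) = g \<oplus> k"
    "(g \<oplus> k) \<otimes> g = g" "(g \<oplus> k) \<otimes> h = h"
proof -
  let ?c = "\<one> \<ominus> g"
  have c: "?c \<in> carrier R" using assms by simp
  have gc: "g \<otimes> ?c = \<zero>" using assms by (simp add: a_minus_def r_distr r_minus r_neg)
  have cc: "?c \<otimes> ?c = ?c"
    using assms gc c by (simp add: minus_eq[of \<one> g] l_distr l_minus)
  show k: "k \<in> carrier R" using c assms by (simp add: k_def)
  have "k \<otimes> k = (?c \<otimes> ?c) \<otimes> (h \<otimes> h)" using c assms(1,3) by (simp add: k_def m_ac)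
  then show kk: "k \<otimes> k = k" by (simp only: cc assms(4) k_def)
  show gk: "g \<otimes> k = \<zero>" using c assms(1,3) gc by (simp add: k_def m_assoc[symmetric])
  then have kg: "k \<otimes> g = \<zero>" using k assms(1) by (simp add: m_comm)
  show "(g \<oplus> k) \<otimes> (g \<oplus> k) = g \<oplus> k" "(g \<oplus> k) \<otimes> g = g"
    using k kk gk kg assms(1,2) by (simp_all add: l_distr r_distr)
  have "k \<otimes> h = k" using c assms(3,4) by (simp add: k_def m_assoc)
  moreover have "k = h \<ominus> g \<otimes> h" using assms(1,3) by (simp add: k_def a_minus_def l_distr l_minus)
  ultimately have "(g \<oplus> k) \<otimes> h = g \<otimes> h \<oplus> (h \<oplus> \<ominus> (g \<otimes> h))"
    using k assms(1,3) by (simp add: l_distr a_minus_def)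
  also have "\<dots> = h" using assms(1,3) by (simp add: a_lcomm r_neg)
  finally show "(g \<oplus> k) \<otimes> h = h" .
qed

text \<open>Quasi-compactness of the spectrum for a cover by open and closed sets, in algebraic
  form: membership of 1 in \<open>J\<close> is witnessed by a single idempotent \<open>g\<close>
  that fixes 1, so \<open>g\<close> is 1.\<close>

lemma iso_upto_glue:
  assumes "cring R" "module R M" "module R N"
    and local: "\<And>P. maximalideal P R \<Longrightarrow>
      \<exists>g. g \<in> carrier R \<and> g \<otimes>\<^bsub>R\<^esub> g = g \<and> g \<notin> P \<and> iso_upto R g M N"
    and "iso_upto R \<zero>\<^bsub>R\<^esub> M N"
  shows "iso_upto R \<one>\<^bsub>R\<^esub> M N"
proof -
  interpret cring R by fact
  define E where "E = {g \<in> carrier R. g \<otimes>\<^bsub>R\<^esub> g = g \<and> iso_upto R g M N}"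
  define J where "J = {a \<in> carrier R. \<exists>g\<in>E. g \<otimes>\<^bsub>R\<^esub> a = a}"
  have join: "\<exists>e\<in>E. e \<otimes>\<^bsub>R\<^esub> g = g \<and> e \<otimes>\<^bsub>R\<^esub> h = h" if g: "g \<in> E" and h: "h \<in> E" for g h
  proof -
    let ?k = "(\<one>\<^bsub>R\<^esub> \<ominus>\<^bsub>R\<^esub> g) \<otimes>\<^bsub>R\<^esub> h"
    have gh: "g \<in> carrier R" "g \<otimes>\<^bsub>R\<^esub> g = g" "h \<in> carrier R" "h \<otimes>\<^bsub>R\<^esub> h = h"
      using g h by (auto simp: E_def)
    have c: "\<one>\<^bsub>R\<^esub> \<ominus>\<^bsub>R\<^esub> g \<in> carrier R" using gh by simp
    have one: "\<one>\<^bsub>R\<^esub> \<otimes>\<^bsub>R\<^esub> \<one>\<^bsub>R\<^esub> = \<one>\<^bsub>R\<^esub>" by simp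
    note k = idempotent_join[OF gh]
    \<comment> \<open>With 1 in place of \<open>h\<close> in \<open>idempotent_join\<close>, the
      disjoint part is 1 - \<open>g\<close> itself.\<close>
    have "(\<one>\<^bsub>R\<^esub> \<ominus>\<^bsub>R\<^esub> g) \<otimes>\<^bsub>R\<^esub> (\<one>\<^bsub>R\<^esub> \<ominus>\<^bsub>R\<^esub> g) = \<one>\<^bsub>R\<^esub> \<ominus>\<^bsub>R\<^esub> g"
      using idempotent_join(2)[OF gh(1,2) one_closed one] gh by simp
    then have "iso_upto R ?k M N"
      using iso_upto_mult[OF assms(2,3) _ c] h by (simp add: E_def)
    then have "iso_upto R (g \<oplus>\<^bsub>R\<^esub> ?k) M N"
      using g k gh by (intro iso_upto_add_orthogonal[OF assms(2,3)]) (auto simp: E_def)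
    with k gh show ?thesis by (intro bexI[of _ "g \<oplus>\<^bsub>R\<^esub> ?k"]) (auto simp: E_def)
  qed
  have "ideal J R"
  proof (rule idealI[OF ring_axioms])
    show "subgroup J (add_monoid R)"
    proof (rule add.subgroupI)
      \<comment> \<open>The assumed isomorphism up to 0 puts 0 into \<open>E\<close>, and so into
        \<open>J\<close>.\<close>
      have "\<zero>\<^bsub>R\<^esub> \<in> J" using assms(5) by (auto simp: J_def E_def intro!: exI[of _ "\<zero>\<^bsub>R\<^esub>"])
      then show "J \<noteq> {}" by blast
      show "\<ominus>\<^bsub>R\<^esub> a \<in> J" if "a \<in> J" for a using that by (auto simp: J_def E_def r_minus)
      show "a \<oplus>\<^bsub>R\<^esub> b \<in> J" if a: "a \<in> J" and b: "b \<in> J" for a b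
      proof -
        obtain g h where gh: "g \<in> E" "h \<in> E" "g \<otimes>\<^bsub>R\<^esub> a = a" "h \<otimes>\<^bsub>R\<^esub> b = b"
          and ab: "a \<in> carrier R" "b \<in> carrier R" using a b by (auto simp: J_def)
        obtain e where e: "e \<in> E" "e \<otimes>\<^bsub>R\<^esub> g = g" "e \<otimes>\<^bsub>R\<^esub> h = h" using join[OF gh(1,2)] by blast
        have c: "g \<in> carrier R" "h \<in> carrier R" "e \<in> carrier R" using gh e by (auto simp: E_def)
        have "e \<otimes>\<^bsub>R\<^esub> a = a" "e \<otimes>\<^bsub>R\<^esub> b = b"
          using m_assoc[OF c(3,1) ab(1)] m_assoc[OF c(3,2) ab(2)] gh(3,4) e(2,3) by simp_all
        with ab c have "e \<otimes>\<^bsub>R\<^esub> (a \<oplus>\<^bsub>R\<^esub> b) = a \<oplus>\<^bsub>R\<^esub> b" by (simp add: r_distr)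
        with e ab show ?thesis by (auto simp: J_def)
      qed
    qed (auto simp: J_def)
    show "x \<otimes>\<^bsub>R\<^esub> a \<in> J" "a \<otimes>\<^bsub>R\<^esub> x \<in> J" if a: "a \<in> J" and x: "x \<in> carrier R" for a x
    proof -
      obtain g where g: "g \<in> E" "g \<in> carrier R" "g \<otimes>\<^bsub>R\<^esub> a = a" "a \<in> carrier R"
        using a by (auto simp: J_def E_def)
      then have "g \<otimes>\<^bsub>R\<^esub> (a \<otimes>\<^bsub>R\<^esub> x) = a \<otimes>\<^bsub>R\<^esub> x" using x by (simp add: m_assoc[symmetric])
      with g x show "a \<otimes>\<^bsub>R\<^esub> x \<in> J" by (auto simp: J_def)
      then show "x \<otimes>\<^bsub>R\<^esub> a \<in> J" using g x by (simp add: m_comm)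
    qed
  qed
  have "\<one>\<^bsub>R\<^esub> \<in> J"
  proof (rule ccontr)
    assume "\<one>\<^bsub>R\<^esub> \<notin> J"
    then obtain P where P: "maximalideal P R" "J \<subseteq> P"
      using exists_maximal_ideal[OF \<open>ideal J R\<close>] by blast
    obtain g where g: "g \<in> carrier R" "g \<otimes>\<^bsub>R\<^esub> g = g" "g \<notin> P" "iso_upto R g M N"
      using local[OF P(1)] by blast
    then have "g \<in> J" by (auto simp: J_def E_def)
    with P(2) g(3) show False by blast
  qed
  then obtain g where "g \<in> E" "g \<otimes>\<^bsub>R\<^esub> \<one>\<^bsub>R\<^esub> = \<one>\<^bsub>R\<^esub>" by (auto simp: J_def)
  moreover then have "g = \<one>\<^bsub>R\<^esub>" by (simp add: E_def)
  ultimately show ?thesis by (simp add: E_def)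
qed

section \<open>Comparing the two modules at a prime\<close>

lemma iso_upto_zero:
  assumes "module R M" "module R N"
  shows "iso_upto R \<zero>\<^bsub>R\<^esub> M N"
proof -
  interpret M: module R M by fact
  interpret N: module R N by fact
  show ?thesis
    by (rule iso_uptoI[where \<phi> = "\<lambda>_. \<zero>\<^bsub>N\<^esub>" and \<psi> = "\<lambda>_. \<zero>\<^bsub>M\<^esub>"]) (auto intro!: mod_homI)
qed

text \<open>Local freeness is transported from the copy \<open>X\<close> inside R^n to
  \<open>M\<close>; this isomorphism has scalar 1, so the idempotent stays the same.\<close>

lemma fg_projective_locally_free:
  fixes R :: "('a, 'r) ring_scheme" and M :: "('a, 'm) module"
  assumes "refinement_ring R" "primeideal P R" "fg_projective R M"
  obtains g r where "g \<in> carrier R" "g \<otimes>\<^bsub>R\<^esub> g = g" "g \<notin> P" "iso_upto R g M (free_mod R r)"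
proof -
  interpret P: primeideal P R by fact
  obtain n and X Y :: "('a, nat \<Rightarrow> 'a) module"
    where XY: "fg_projective R X" "fg_projective R Y" "iso_upto R \<one>\<^bsub>R\<^esub> M X"
      "iso_upto R \<one>\<^bsub>R\<^esub> (dsum X Y) (free_mod R n)"
    using fg_projective_complement[OF assms(3)] by blast
  obtain g r where g: "g \<in> carrier R" "g \<otimes>\<^bsub>R\<^esub> g = g" "g \<notin> P" "iso_upto R g X (free_mod R r)"
    using refinement_ring_locally_free[OF assms(1,2) XY(1,2,4)] by blast
  have "module R M" "module R X" using assms XY by (auto simp: fg_projective_def)
  from iso_upto_trans[OF this free_mod_module[OF P.cring_axioms] XY(3) g(4)] g
  show ?thesis using that[of g r] by simp
qed

text \<open>This replaces the scalar \<open>s\<close> by an idempotent. Over \<open>g\<close> and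
  \<open>h\<close> the modules are free of ranks \<open>r\<close> and \<open>q\<close>; passing from
  one free module to the other through \<open>M\<close> and \<open>N\<close> yields a scalar outside
  \<open>P\<close>, which forces the ranks to agree.\<close>

lemma iso_upto_idempotent_at_prime:
  fixes R :: "('a, 'r) ring_scheme" and M :: "('a, 'm) module" and N :: "('a, 'n) module"
  assumes "refinement_ring R" "primeideal P R" "fg_projective R M" "fg_projective R N"
    and "iso_upto R s M N" "s \<in> carrier R - P"
  shows "\<exists>g. g \<in> carrier R \<and> g \<otimes>\<^bsub>R\<^esub> g = g \<and> g \<notin> P \<and> iso_upto R g M N"
proof -
  interpret P: primeideal P R by fact
  note free = free_mod_module[OF P.cring_axioms]
  have MN: "module R M" "module R N" using assms by (auto simp: fg_projective_def)
  obtain g r where g: "g \<in> carrier R" "g \<otimes>\<^bsub>R\<^esub> g = g" "g \<notin> P" "iso_upto R g M (free_mod R r)"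
    using fg_projective_locally_free[OF assms(1-3)] by blast
  obtain h q where h: "h \<in> carrier R" "h \<otimes>\<^bsub>R\<^esub> h = h" "h \<notin> P" "iso_upto R h N (free_mod R q)"
    using fg_projective_locally_free[OF assms(1,2,4)] by blast
  have "iso_upto R ((g \<otimes>\<^bsub>R\<^esub> s) \<otimes>\<^bsub>R\<^esub> h) (free_mod R r) (free_mod R q)"
    by (intro iso_upto_trans[OF free MN(2) free _ h(4)]
        iso_upto_trans[OF free MN iso_upto_sym[OF g(4)] assms(5)])
  moreover have "(g \<otimes>\<^bsub>R\<^esub> s) \<otimes>\<^bsub>R\<^esub> h \<notin> P"
    using P.denominator_closed(2) g h assms(6) by blast
  ultimately have "r = q"
    using free_mod_rank_le[OF assms(2)] iso_upto_sym by (metis antisym)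
  \<comment> \<open>The new isomorphism runs through the common free module, so \<open>s\<close> no
    longer enters and only idempotent scalars remain.\<close>
  then have "iso_upto R (g \<otimes>\<^bsub>R\<^esub> h) M N"
    using iso_upto_trans[OF MN(1) free MN(2) g(4)] iso_upto_sym[OF h(4)] by blast
  moreover have "g \<otimes>\<^bsub>R\<^esub> h \<notin> P" using P.denominator_closed(2) g h by blast
  moreover have "(g \<otimes>\<^bsub>R\<^esub> h) \<otimes>\<^bsub>R\<^esub> (g \<otimes>\<^bsub>R\<^esub> h) = (g \<otimes>\<^bsub>R\<^esub> g) \<otimes>\<^bsub>R\<^esub> (h \<otimes>\<^bsub>R\<^esub> h)"
    using g(1) h(1) by (simp add: P.m_ac)
  ultimately show ?thesis using g h by (intro exI[of _ "g \<otimes>\<^bsub>R\<^esub> h"]) simp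
qed

theorem theorem2p5:
  fixes R :: "'a ring" and M :: "('a, 'm) module" and N :: "('a, 'n) module"
  assumes "cring R"
    and "refinement_ring R"
    and "fg_projective R M"
    and "fg_projective R N"
  shows "mod_iso R M N \<longleftrightarrow>
         (\<forall>P. maximalideal P R \<longrightarrow>
              mod_iso (loc_ring R P) (loc_mod R M P) (loc_mod R N P))"
proof -
  interpret cring R by fact
  have MN: "module R M" "module R N" using assms(3,4) by (auto simp: fg_projective_def)
  show ?thesis
  proof (intro iffI allI impI)
    fix P assume "mod_iso R M N" "maximalideal P R"
    then show "mod_iso (loc_ring R P) (loc_mod R M P) (loc_mod R N P)"
      using iso_upto_imp_mod_iso_loc_mod[OF MN maximalideal_prime]
      by (simp add: mod_iso_iff_iso_upto_one MN)
  next
    assume loc: "\<forall>P. maximalideal P R \<longrightarrow> mod_iso (loc_ring R P) (loc_mod R M P) (loc_mod R N P)"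
    have "\<exists>g. g \<in> carrier R \<and> g \<otimes>\<^bsub>R\<^esub> g = g \<and> g \<notin> P \<and> iso_upto R g M N"
      if P: "maximalideal P R" for P
    proof -
      note prime = maximalideal_prime[OF P]
      obtain s where "s \<in> carrier R - P" "iso_upto R s M N"
        using mod_iso_loc_mod_imp_iso_upto[OF assms(3,4) prime] loc P by blast
      then show ?thesis
        using iso_upto_idempotent_at_prime[OF assms(2) prime assms(3,4)] by blast
    qed
    from iso_upto_glue[OF assms(1) MN this iso_upto_zero[OF MN]]
    show "mod_iso R M N" by (simp add: mod_iso_iff_iso_upto_one MN)
  qed
qed

end
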